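(* Let $\mathbf{P}\subset\mathbb{R}$ be a nonempty union of finitely many compact real intervals with $\overline{\operatorname{int}\mathbf{P}}=\mathbf{P}$ and $0\notin\mathbf{P}$. Let $A\in\mathbb{R}^{n\times n}$ and $B\in\mathbb{R}^{n\times m}$ be fixed matrices. (a) If the family $\Sigma=\{(\theta A,B)\;|\;\theta\in\mathbf{P}\}$ is uniformly ensemble controllable, then $(A,B)$ is controllable and $A$ is invertible. (b) Let $(A,B)$ be controllable and let $A$ be invertible and diagonalizable (over $\mathbb{C}$), with distinct eigenvalues $\lambda_1,\ldots,\lambda_r\in\mathbb{C}$, such that $\lambda_k\mathbf{P}\cap\lambda_l\mathbf{P}=\emptyset$ for all $k\neq l\in\{1,\ldots,r\}$. Then the family $\Sigma=\{(\theta A,B)\;|\;\theta\in\mathbf{P}\}$ is uniformly ensemble controllable.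
   Context: $\lambda\mathbf{P}:=\{\lambda\theta\;|\;\theta\in\mathbf{P}\}$. A pair $(A,B)$ is controllable if $\operatorname{rank}(B\ AB\ \cdots\ A^{n-1}B)=n$. The family $\{(\theta A,B)\;|\;\theta\in\mathbf{P}\}$ is uniformly ensemble controllable if for every $x^*\in C(\mathbf{P},\mathbb{R}^n)$ and every $\varepsilon>0$ there exist $T>0$ and a $\theta$-independent input $u$ such that $\sup_{\theta\in\mathbf{P}}\|\varphi(T,\theta,u)-x^*(\theta)\|<\varepsilon$. In continuous time, $u\in L^1([0,T],\mathbb{R}^m)$ and $\varphi(T,\theta,u)=\int_0^Te^{\theta A(T-s)}Bu(s)\,ds$ (the solution at time $T$ of $\dot x=\theta Ax+Bu$, $x(0)=0$). In discrete time, $T$ is a positive integer, $u=(u_0,\ldots,u_{T-1})$ is a sequence in $\mathbb{R}^m$ and $\varphi(T,\theta,u)=\sum_{k=0}^{T-1}(\theta A)^kBu_{T-1-k}$. The claim is asserted for each of the two notions. *)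

theory Defs
  imports "HOL-Analysis.Analysis"
begin

(* The class operations * and ^ on vec types act entrywise, so the powers and the exponential
   of a matrix have to be built from ** instead. *)
primrec matpow :: "'a::semiring_1 ^ 'n ^ 'n \<Rightarrow> nat \<Rightarrow> 'a ^ 'n ^ 'n" where
  "matpow M 0 = mat 1"
| "matpow M (Suc k) = M ** matpow M k"

definition matexp :: "real ^ 'n ^ 'n \<Rightarrow> real ^ 'n ^ 'n" where
  "matexp M = (\<Sum>k. matpow M k /\<^sub>R fact k)"

(* The n x (n m) block matrix (B  AB  ...  A^(n-1) B). Its columns are indexed by pairs (k, j):
   k selects the block and j the column inside it. As the block index ranges over the type 'n,
   to_nat_on UNIV is used to enumerate 'n bijectively by the exponents 0, ..., CARD('n) - 1. *)
definition kalman_matrix :: "real ^ 'n ^ 'n \<Rightarrow> real ^ 'm ^ 'n \<Rightarrow> real ^ ('n \<times> 'm) ^ 'n" where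
  "kalman_matrix A B = (\<chi> i kj. (matpow A (to_nat_on UNIV (fst kj)) ** B) $ i $ snd kj)"

definition controllable :: "real ^ 'n ^ 'n \<Rightarrow> real ^ 'm ^ 'n \<Rightarrow> bool" where
  "controllable A (B :: real ^ 'm ^ 'n) \<longleftrightarrow> rank (kalman_matrix A B) = CARD('n)"

definition ct_state ::
    "real ^ 'n ^ 'n \<Rightarrow> real ^ 'm ^ 'n \<Rightarrow> real \<Rightarrow> real \<Rightarrow> (real \<Rightarrow> real ^ 'm) \<Rightarrow> real ^ 'n" where
  "ct_state A B T \<theta> u =
     (LINT s:{0..T}|lebesgue. matexp ((T - s) *\<^sub>R (\<theta> *\<^sub>R A)) *v (B *v u s))"

definition dt_state ::
    "real ^ 'n ^ 'n \<Rightarrow> real ^ 'm ^ 'n \<Rightarrow> nat \<Rightarrow> real \<Rightarrow> (nat \<Rightarrow> real ^ 'm) \<Rightarrow> real ^ 'n" where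
  "dt_state A B T \<theta> u = (\<Sum>k<T. matpow (\<theta> *\<^sub>R A) k *v (B *v u (T - 1 - k)))"

(* The suprema are taken in ereal because an unbounded Sup has no meaningful value in real. *)
definition ct_uniformly_ensemble_controllable ::
    "real set \<Rightarrow> real ^ 'n ^ 'n \<Rightarrow> real ^ 'm ^ 'n \<Rightarrow> bool" where
  "ct_uniformly_ensemble_controllable P A B \<longleftrightarrow>
     (\<forall>x. continuous_on P x \<longrightarrow> (\<forall>\<epsilon>>0. \<exists>T>0. \<exists>u. u absolutely_integrable_on {0..T} \<and>
        (SUP \<theta>\<in>P. ereal (norm (ct_state A B T \<theta> u - x \<theta>))) < ereal \<epsilon>))"

(* Only the values u 0, ..., u (T - 1) of the input sequence enter dt_state. *)
definition dt_uniformly_ensemble_controllable ::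
    "real set \<Rightarrow> real ^ 'n ^ 'n \<Rightarrow> real ^ 'm ^ 'n \<Rightarrow> bool" where
  "dt_uniformly_ensemble_controllable P A B \<longleftrightarrow>
     (\<forall>x. continuous_on P x \<longrightarrow> (\<forall>\<epsilon>>0. \<exists>T>0. \<exists>u.
        (SUP \<theta>\<in>P. ereal (norm (dt_state A B T \<theta> u - x \<theta>))) < ereal \<epsilon>))"

definition eigenvalues :: "'a::field ^ 'n ^ 'n \<Rightarrow> 'a set" where
  "eigenvalues M = {\<mu>. \<exists>v. v \<noteq> 0 \<and> M *v v = \<mu> *s v}"

definition diagonalizable :: "'a::field ^ 'n ^ 'n \<Rightarrow> bool" where
  "diagonalizable (M :: 'a ^ 'n ^ 'n) \<longleftrightarrow>
     (\<exists>(S :: 'a ^ 'n ^ 'n) (D :: 'a ^ 'n ^ 'n). invertible S \<and> (\<forall>i j. i \<noteq> j \<longrightarrow> D $ i $ j = 0) \<and> M = S ** D ** matrix_inv S)"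

abbreviation complex_matrix :: "real ^ 'n ^ 'm \<Rightarrow> complex ^ 'n ^ 'm" where
  "complex_matrix \<equiv> map_matrix complex_of_real"

definition scaled_set :: "complex \<Rightarrow> real set \<Rightarrow> complex set" where
  "scaled_set \<mu> P = (\<lambda>\<theta>. \<mu> * complex_of_real \<theta>) ` P"

end

theory Submission
  imports Defs
begin

text \<open>
  For necessity, a vector \<open>w\<close> orthogonal to all \<open>A^k B v\<close> makes \<open>w \<bullet> x(T, \<theta>)\<close> vanish, and a vector
  orthogonal to the range of \<open>A\<close> makes it independent of \<open>\<theta>\<close>; neither is compatible with density.

  For sufficiency, the discrete-time states are the functions \<open>\<theta> \<mapsto> \<Sum>k. \<theta>^k A^k B w\<^sub>k\<close>. On the eigenspace
  of \<open>\<mu>\<close> the operator \<open>p(\<theta>A)\<close> acts as the scalar \<open>p(\<mu>\<theta>)\<close>, so it suffices that polynomials are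
  dense in the continuous functions on the disjoint union \<open>K\<close> of the sets \<open>\<mu>P\<close>. As \<open>K\<close> is compact,
  avoids \<open>0\<close> and lies on finitely many lines through \<open>0\<close>, this needs no Mergelyan theorem: indicators
  of half-planes bounded by lines through \<open>0\<close> that miss \<open>K\<close> are limits of polynomials on \<open>K\<close>, hence so
  are indicators of rays, and the limits of polynomials that are real on \<open>K\<close> then separate points, so
  that Stone--Weierstrass applies. In continuous time, short constant inputs recover the monomials
  \<open>\<theta>^k A^k B w\<close> in the uniform closure, whence the discrete-time result carries over.
\<close>

subsection \<open>Uniform closures\<close>

text \<open>Functions are total here, so values off \<open>S\<close> are unconstrained: membership
  depends only on the restriction to \<open>S\<close>.\<close>

definition uniform_closure :: "'b set \<Rightarrow> ('b \<Rightarrow> 'a::real_normed_vector) set \<Rightarrow> ('b \<Rightarrow> 'a) set" where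
  "uniform_closure S V = {f. \<forall>e>0. \<exists>g\<in>V. \<forall>x\<in>S. norm (g x - f x) < e}"

lemma uniform_closureI:
  "(\<And>e. e > 0 \<Longrightarrow> \<exists>g\<in>V. \<forall>x\<in>S. norm (g x - f x) < e) \<Longrightarrow> f \<in> uniform_closure S V"
  by (simp add: uniform_closure_def)

lemma uniform_closureE:
  assumes "f \<in> uniform_closure S V" "e > 0"
  obtains g where "g \<in> V" "\<And>x. x \<in> S \<Longrightarrow> norm (g x - f x) < e"
  using assms by (auto simp: uniform_closure_def)

lemma uniform_closure_base: "f \<in> V \<Longrightarrow> f \<in> uniform_closure S V"
  by (auto intro!: uniform_closureI bexI[of _ f])

lemma uniform_closure_cong:
  assumes "f \<in> uniform_closure S V" "\<And>x. x \<in> S \<Longrightarrow> f x = g x"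
  shows "g \<in> uniform_closure S V"
  using assms by (auto simp: uniform_closure_def)

lemma uniform_closure_mono:
  assumes "V \<subseteq> uniform_closure S W"
  shows "uniform_closure S V \<subseteq> uniform_closure S W"
proof
  fix f assume f: "f \<in> uniform_closure S V"
  show "f \<in> uniform_closure S W"
  proof (rule uniform_closureI)
    fix e :: real assume e: "e > 0"
    obtain g where g: "g \<in> V" "\<And>x. x \<in> S \<Longrightarrow> norm (g x - f x) < e/2"
      using uniform_closureE[OF f, of "e/2"] e by auto
    obtain h where h: "h \<in> W" "\<And>x. x \<in> S \<Longrightarrow> norm (h x - g x) < e/2"
      using uniform_closureE[of g S W "e/2"] g(1) assms e by auto
    have "norm (h x - f x) < e" if "x \<in> S" for x
      using norm_triangle_ineq[of "h x - g x" "g x - f x"] g(2)[OF that] h(2)[OF that] by simp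
    then show "\<exists>g\<in>W. \<forall>x\<in>S. norm (g x - f x) < e" using h(1) by blast
  qed
qed

text \<open>Idempotence of the closure: the approximants may themselves be limits, which spares
  later density proofs a second epsilon argument.\<close>

lemma uniform_closure_limit:
  assumes "\<And>e. e > 0 \<Longrightarrow> \<exists>g\<in>uniform_closure S V. \<forall>x\<in>S. norm (g x - f x) < e"
  shows "f \<in> uniform_closure S V"
  using uniform_closure_mono[of "uniform_closure S V" S V] uniform_closureI[OF assms] by auto

text \<open>Real scalars fit the real-valued states; in \<open>poly_closure\<close>, complex scalars
  enter through multiplication by constant functions.\<close>

locale function_subspace =
  fixes V :: "('b \<Rightarrow> 'a::real_normed_vector) set"
  assumes zero: "(\<lambda>x. 0) \<in> V"
    and add: "f \<in> V \<Longrightarrow> g \<in> V \<Longrightarrow> (\<lambda>x. f x + g x) \<in> V"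
    and scale: "f \<in> V \<Longrightarrow> (\<lambda>x. c *\<^sub>R f x) \<in> V"
begin

lemma sum: "(\<And>i. i \<in> I \<Longrightarrow> f i \<in> V) \<Longrightarrow> (\<lambda>x. \<Sum>i\<in>I. f i x) \<in> V"
  by (induction I rule: infinite_finite_induct) (auto intro: zero add)

lemma closure_subspace: "function_subspace (uniform_closure S V)"
proof
  show "(\<lambda>x. 0) \<in> uniform_closure S V" by (rule uniform_closure_base[OF zero])
next
  fix f g assume f: "f \<in> uniform_closure S V" and g: "g \<in> uniform_closure S V"
  show "(\<lambda>x. f x + g x) \<in> uniform_closure S V"
  proof (rule uniform_closureI)
    fix e :: real assume e: "e > 0"
    obtain f' where f': "f' \<in> V" "\<And>x. x \<in> S \<Longrightarrow> norm (f' x - f x) < e/2"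
      using uniform_closureE[OF f, of "e/2"] e by auto
    obtain g' where g': "g' \<in> V" "\<And>x. x \<in> S \<Longrightarrow> norm (g' x - g x) < e/2"
      using uniform_closureE[OF g, of "e/2"] e by auto
    have "norm (f' x + g' x - (f x + g x)) < e" if "x \<in> S" for x
      using norm_triangle_ineq[of "f' x - f x" "g' x - g x"] f'(2)[OF that] g'(2)[OF that]
      by (simp add: add_diff_add)
    then show "\<exists>h\<in>V. \<forall>x\<in>S. norm (h x - (f x + g x)) < e"
      by (intro bexI[OF _ add[OF f'(1) g'(1)]]) simp
  qed
next
  fix f c assume f: "f \<in> uniform_closure S V"
  show "(\<lambda>x. c *\<^sub>R f x) \<in> uniform_closure S V"
  proof (rule uniform_closureI)
    fix e :: real assume e: "e > 0"
    \<comment> \<open>The added 1 covers the case \<open>c = 0\<close>.\<close>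
    obtain f' where f': "f' \<in> V" "\<And>x. x \<in> S \<Longrightarrow> norm (f' x - f x) < e/(\<bar>c\<bar> + 1)"
      using uniform_closureE[OF f, of "e/(\<bar>c\<bar> + 1)"] e by auto
    have "norm (c *\<^sub>R f' x - c *\<^sub>R f x) < e" if "x \<in> S" for x
    proof -
      have "norm (c *\<^sub>R f' x - c *\<^sub>R f x) = \<bar>c\<bar> * norm (f' x - f x)"
        by (simp flip: scaleR_diff_right)
      also have "\<dots> \<le> (\<bar>c\<bar> + 1) * norm (f' x - f x)" by (simp add: mult_right_mono)
      also have "\<dots> < e"
        using f'(2)[OF that] by (simp add: field_simps)
      finally show ?thesis .
    qed
    then show "\<exists>h\<in>V. \<forall>x\<in>S. norm (h x - c *\<^sub>R f x) < e"
      by (intro bexI[OF _ scale[OF f'(1), of c]]) simp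
  qed
qed

end

subsection \<open>The algebra of uniform limits of polynomials\<close>

text \<open>For compact \<open>K\<close> this is the uniform algebra P(K), except that its members
  are functions on the whole plane, compared only on \<open>K\<close>.\<close>

definition poly_closure :: "complex set \<Rightarrow> (complex \<Rightarrow> complex) set" where
  "poly_closure K = uniform_closure K (range poly)"

lemma poly_closureE:
  assumes "f \<in> poly_closure K" "e > 0"
  obtains p where "\<And>x. x \<in> K \<Longrightarrow> norm (poly p x - f x) < e"
  using assms unfolding poly_closure_def by (elim uniform_closureE) auto

lemma poly_closure_subspace: "function_subspace (poly_closure K)"
proof -
  interpret function_subspace "range poly :: (complex \<Rightarrow> complex) set"
  proof
    show "(\<lambda>x. 0) \<in> range poly" by (rule range_eqI[of _ _ 0]) auto
    show "(\<lambda>x. f x + g x) \<in> range poly" if "f \<in> range poly" "g \<in> range poly" 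
      for f g :: "complex \<Rightarrow> complex"
      using that by (metis (no_types, lifting) ext poly_add rangeE rangeI)
    show "(\<lambda>x. c *\<^sub>R f x) \<in> range poly" if "f \<in> range poly" for f :: "complex \<Rightarrow> complex" and c
      using that by (metis (no_types, lifting) ext poly_smult scaleR_conv_of_real rangeE rangeI)
  qed
  show ?thesis unfolding poly_closure_def by (rule closure_subspace)
qed

lemma poly_in_closure: "(\<lambda>z. poly p z) \<in> poly_closure K"
  unfolding poly_closure_def by (rule uniform_closure_base) auto

lemma const_in_closure: "(\<lambda>z. c) \<in> poly_closure K"
  using poly_in_closure[of "[:c:]"] by simp

lemma poly_closure_bounded:
  assumes "compact K" "f \<in> poly_closure K"
  shows "bounded (f ` K)"
proof -
  obtain p where p: "\<And>x. x \<in> K \<Longrightarrow> norm (poly p x - f x) < 1"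
    using poly_closureE[OF assms(2) zero_less_one] by blast
  have "bounded (poly p ` K)"
    by (intro compact_imp_bounded compact_continuous_image assms continuous_intros)
  then obtain b where b: "\<And>x. x \<in> K \<Longrightarrow> norm (poly p x) \<le> b" by (auto simp: bounded_iff)
  have "norm (f x) \<le> b + 1" if "x \<in> K" for x
    using b[OF that] p[OF that] norm_triangle_ineq4[of "poly p x" "poly p x - f x"] by simp
  then show ?thesis by (auto simp: bounded_iff)
qed

lemma poly_closure_continuous:
  assumes "f \<in> poly_closure K"
  shows "continuous_on K f"
proof -
  have "\<exists>p. \<forall>x\<in>K. norm (poly p x - f x) < inverse (Suc n)" for n
    using poly_closureE[OF assms, of "inverse (Suc n)"]
    by (metis inverse_positive_iff_positive of_nat_0_less_iff zero_less_Suc)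
  then obtain p where p: "\<And>n x. x \<in> K \<Longrightarrow> norm (poly (p n) x - f x) < inverse (Suc n)" by metis
  have "uniform_limit K (\<lambda>n. poly (p n)) f sequentially"
    unfolding uniform_limit_iff
  proof safe
    fix e :: real assume "e > 0"
    then have "\<forall>\<^sub>F n in sequentially. inverse (Suc n) < e"
      using order_tendstoD(2)[OF LIMSEQ_inverse_real_of_nat] by blast
    then show "\<forall>\<^sub>F n in sequentially. \<forall>x\<in>K. dist (poly (p n) x) (f x) < e"
      by eventually_elim (use p in \<open>auto simp: dist_norm intro: less_trans\<close>)
  qed
  then show ?thesis
    by (rule uniform_limit_theorem[rotated]) (auto intro!: always_eventually continuous_intros)
qed

lemma poly_closure_mult:
  assumes K: "compact K" and f: "f \<in> poly_closure K" and g: "g \<in> poly_closure K"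
  shows "(\<lambda>z. f z * g z) \<in> poly_closure K"
  unfolding poly_closure_def
proof (rule uniform_closureI)
  fix e :: real assume e: "e > 0"
  obtain b where b: "b > 0" "\<And>x. x \<in> K \<Longrightarrow> norm (g x) \<le> b"
    using poly_closure_bounded[OF K g] by (auto simp: bounded_pos)
  obtain p where p: "\<And>x. x \<in> K \<Longrightarrow> norm (poly p x - f x) < e / (2*b)"
    using poly_closureE[OF f, of "e/(2*b)"] b(1) e by (metis divide_pos_pos mult_pos_pos zero_less_numeral)
  have "bounded (poly p ` K)"
    by (intro compact_imp_bounded compact_continuous_image K continuous_intros)
  then obtain c where c: "c > 0" "\<And>x. x \<in> K \<Longrightarrow> norm (poly p x) \<le> c" by (auto simp: bounded_pos)
  \<comment> \<open>\<open>q\<close> comes after \<open>p\<close>, because its accuracy depends on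
    the bound \<open>c\<close> for \<open>p\<close> on \<open>K\<close>.\<close>
  obtain q where q: "\<And>x. x \<in> K \<Longrightarrow> norm (poly q x - g x) < e / (2*c)"
    using poly_closureE[OF g, of "e/(2*c)"] c(1) e by (metis divide_pos_pos mult_pos_pos zero_less_numeral)
  have "norm (poly (p * q) x - f x * g x) < e" if x: "x \<in> K" for x
  proof -
    have "poly (p * q) x - f x * g x = poly p x * (poly q x - g x) + (poly p x - f x) * g x"
      by (simp add: algebra_simps)
    also have "norm \<dots> \<le> norm (poly p x) * norm (poly q x - g x) + norm (poly p x - f x) * norm (g x)"
      by (metis norm_triangle_ineq norm_mult)
    also have "\<dots> \<le> c * norm (poly q x - g x) + norm (poly p x - f x) * b"
      by (intro add_mono mult_mono c b x less_imp_le[OF c(1)]) auto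
    also have "\<dots> < e/2 + e/2"
    proof (rule add_strict_mono)
      show "c * norm (poly q x - g x) < e/2" using q[OF x] c(1) by (simp add: field_simps)
      show "norm (poly p x - f x) * b < e/2" using p[OF x] b(1) by (simp add: field_simps)
    qed
    finally show ?thesis by simp
  qed
  then show "\<exists>h\<in>range poly. \<forall>x\<in>K. norm (h x - f x * g x) < e" by blast
qed

lemma poly_closure_prod:
  assumes "compact K" "\<And>i. i \<in> I \<Longrightarrow> f i \<in> poly_closure K"
  shows "(\<lambda>z. \<Prod>i\<in>I. f i z) \<in> poly_closure K"
  using assms(2)
  by (induction I rule: infinite_finite_induct)
     (auto intro!: poly_closure_mult assms(1) const_in_closure)

lemma poly_closure_power:
  assumes "compact K" "f \<in> poly_closure K"
  shows "(\<lambda>z. f z ^ n) \<in> poly_closure K"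
  using poly_closure_prod[of K "{..<n}" "\<lambda>_. f"] assms by simp

text \<open>Geometric series: with x = -h/f one has f + h = f (1 - x) and |x| \<le> 1/2 on
  \<open>K\<close>, so the inverse is the uniform limit of the partial sums of x^k divided by
  f.\<close>

lemma poly_closure_inverse_perturb:
  assumes K: "compact K" and f: "f \<in> poly_closure K" and h: "h \<in> poly_closure K"
    and inv: "(\<lambda>z. inverse (f z)) \<in> poly_closure K"
    and m: "m > 0" "\<And>z. z \<in> K \<Longrightarrow> norm (f z) \<ge> m" "\<And>z. z \<in> K \<Longrightarrow> norm (h z) \<le> m/2"
  shows "(\<lambda>z. inverse (f z + h z)) \<in> poly_closure K"
  unfolding poly_closure_def
proof (rule uniform_closure_limit, fold poly_closure_def)
  interpret function_subspace "poly_closure K" by (rule poly_closure_subspace)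
  fix e :: real assume e: "e > 0"
  define x where "x = (\<lambda>z. (- 1) * h z * inverse (f z))"
  have x: "x \<in> poly_closure K"
    unfolding x_def by (intro poly_closure_mult K const_in_closure h inv)
  \<comment> \<open>This sequence bounds the error |x|^n / (|f| |1 - x|) of the partial sum, as |f|
    \<ge> m and |1 - x| \<ge> 1/2.\<close>
  have "(\<lambda>n. 2/m * (1/2)^n) \<longlonglongrightarrow> 2/m * 0"
    by (intro tendsto_intros LIMSEQ_power_zero) auto
  then have "\<forall>\<^sub>F n in sequentially. 2/m * (1/2)^n < e"
    using e by (intro order_tendstoD) auto
  then obtain n where n: "2/m * (1/2)^n < e" by (auto simp: eventually_sequentially)
  define g where "g = (\<lambda>z. inverse (f z) * (\<Sum>k<n. x z ^ k))"
  have "g \<in> poly_closure K"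
    unfolding g_def by (intro poly_closure_mult K inv sum poly_closure_power x)
  moreover have "norm (g z - inverse (f z + h z)) < e" if z: "z \<in> K" for z
  proof -
    have f0: "f z \<noteq> 0" using m(1) m(2)[OF z] by auto
    have "norm (x z) = norm (h z) / norm (f z)" by (simp add: x_def norm_mult norm_inverse divide_inverse)
    also have "\<dots> \<le> (m/2) / m" using m z by (intro frac_le) auto
    finally have nx: "norm (x z) \<le> 1/2" using m by simp
    have nx1: "norm (1 - x z) \<ge> 1/2"
      using norm_triangle_ineq2[of 1 "x z"] nx by simp
    then have x1: "x z \<noteq> 1" by auto
    have fh: "f z + h z = f z * (1 - x z)" using f0 by (simp add: x_def field_simps)
    have "(\<Sum>k<n. x z ^ k) = (1 - x z ^ n) * inverse (1 - x z)"
      unfolding geometric_sum[OF x1] using x1 by (simp add: divide_simps) (simp add: algebra_simps)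
    then have "g z - inverse (f z + h z) = - inverse (f z) * x z ^ n * inverse (1 - x z)"
      unfolding g_def fh inverse_mult_distrib by (simp only:) (simp add: algebra_simps)
    also have "norm \<dots> = inverse (norm (f z)) * norm (x z) ^ n * inverse (norm (1 - x z))"
      by (simp add: norm_mult norm_inverse norm_power)
    also have "\<dots> \<le> inverse m * (1/2)^n * inverse (1/2)"
      by (intro mult_mono power_mono le_imp_inverse_le m z nx nx1) (use m in auto)
    also have "\<dots> < e" using n by (simp add: field_simps)
    finally show ?thesis .
  qed
  ultimately show "\<exists>g\<in>poly_closure K. \<forall>z\<in>K. norm (g z - inverse (f z + h z)) < e" by blast
qed

text \<open>\<open>p\<close> is joined to the constant \<open>p 0\<close> by the path \<open>t \<mapsto> p (t * z)\<close>, along which the inverse is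
  propagated by finitely many small perturbations.\<close>

lemma poly_closure_inverse:
  assumes K: "compact K" and nz: "\<And>t z. 0 \<le> t \<Longrightarrow> t \<le> 1 \<Longrightarrow> z \<in> K \<Longrightarrow> poly p (of_real t * z) \<noteq> 0"
  shows "(\<lambda>z. inverse (poly p z)) \<in> poly_closure K"
proof (cases "K = {}")
  case True
  then show ?thesis using const_in_closure[of undefined K] by (auto simp: poly_closure_def uniform_closure_def)
next
  case False
  interpret function_subspace "poly_closure K" by (rule poly_closure_subspace)
  define G where "G = (\<lambda>(t, z). poly p (of_real t * z))"
  have KK: "compact ({0..1::real} \<times> K)" by (intro compact_Times K compact_Icc)
  have G: "continuous_on ({0..1::real} \<times> K) G"
    unfolding G_def case_prod_beta by (intro continuous_intros)
  obtain m where m: "m > 0" "\<And>t z. t \<in> {0..1} \<Longrightarrow> z \<in> K \<Longrightarrow> norm (G (t, z)) \<ge> m"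
  proof -
    have "continuous_on ({0..1} \<times> K) (\<lambda>x. norm (G x))" by (intro continuous_intros G)
    from continuous_attains_inf[OF KK _ this] False
    obtain x0 where x0: "x0 \<in> {0..1} \<times> K" "\<And>y. y \<in> {0..1} \<times> K \<Longrightarrow> norm (G x0) \<le> norm (G y)" by auto
    have "norm (G x0) > 0" using x0(1) nz by (auto simp: G_def)
    with x0(2) show ?thesis by (intro that[of "norm (G x0)"]) auto
  qed
  have "uniformly_continuous_on ({0..1} \<times> K) G" by (rule compact_uniformly_continuous[OF G KK])
  then obtain d where d: "d > 0" 
    "\<And>x y. x \<in> {0..1} \<times> K \<Longrightarrow> y \<in> {0..1} \<times> K \<Longrightarrow> dist x y < d \<Longrightarrow> dist (G x) (G y) < m/2"
    unfolding uniformly_continuous_on_def using m(1) by (metis half_gt_zero)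
  \<comment> \<open>With step length 1/(N+1) below the modulus \<open>d\<close>, consecutive
    functions on the path differ by at most m/2, the size of perturbation that can be
    inverted.\<close>
  obtain N :: nat where N: "inverse (of_nat (Suc N)) < d" using d(1) reals_Archimedean by blast
  have Gin: "(\<lambda>z. G (t, z)) \<in> poly_closure K" for t
    using poly_in_closure[of "pcompose p [:0, of_real t:]" K] by (simp add: G_def poly_pcompose mult.commute)
  have "j \<le> Suc N \<Longrightarrow> (\<lambda>z. inverse (G (j / Suc N, z))) \<in> poly_closure K" for j
  proof (induction j)
    case 0
    then show ?case by (simp add: G_def const_in_closure)
  next
    case (Suc j)
    let ?s = "real j / Suc N" and ?t = "real (Suc j) / Suc N"
    have s: "?s \<in> {0..1}" and t: "?t \<in> {0..1}" using Suc.prems by auto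
    have st: "\<bar>?t - ?s\<bar> < d" using N by (simp add: field_simps)
    have "norm (G (?t, z) + (-1) *\<^sub>R G (?s, z)) \<le> m/2" if "z \<in> K" for z
    proof -
      have "dist (?t, z) (?s, z) < d" using st by (simp add: dist_Pair_Pair dist_real_def)
      then show ?thesis using d(2)[of "(?t,z)" "(?s,z)"] s t that by (simp add: dist_norm)
    qed
    moreover have "(\<lambda>z. G (?t, z) + (-1) *\<^sub>R G (?s, z)) \<in> poly_closure K"
      by (intro add scale Gin)
    ultimately have "(\<lambda>z. inverse (G (?s, z) + (G (?t, z) + (-1) *\<^sub>R G (?s, z)))) \<in> poly_closure K"
      using Suc m s by (intro poly_closure_inverse_perturb[where m = m] K Gin) auto
    then show ?case by simp
  qed
  from this[of "Suc N"] show ?thesis by (simp add: G_def)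
qed

subsection \<open>Polynomial density on finitely many lines\<close>

text \<open>With x = (b/a)^(2N) the quotient is x/(1 + x), and |x| \<le> q^N \<le> 1/2 keeps the
  denominator at least 1/2. The even exponent matches the hypothesis on squared norms.\<close>

lemma ratio_power_bound:
  fixes a b :: complex
  assumes ab: "norm b ^ 2 \<le> q * norm a ^ 2" and a: "a \<noteq> 0" and q: "0 \<le> q" "q ^ N \<le> 1/2"
  shows "norm (b ^ (2*N) * inverse (a ^ (2*N) + b ^ (2*N))) \<le> 2 * q ^ N"
proof -
  define x where "x = b ^ (2*N) / a ^ (2*N)"
  have "norm b ^ (2*N) \<le> q ^ N * norm a ^ (2*N)"
    using power_mono[OF ab, of N] by (simp add: power_mult power_mult_distrib)
  then have x: "norm x \<le> q ^ N"
    using a by (simp add: x_def norm_divide norm_power divide_simps)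
  have x1: "norm (1 + x) \<ge> 1/2"
    using norm_triangle_ineq2[of 1 "- x"] x q(2) by simp
  then have x0: "1 + x \<noteq> 0" by auto
  have "b ^ (2*N) * inverse (a ^ (2*N) + b ^ (2*N)) = x * inverse (1 + x)"
    using a x0 by (simp add: x_def divide_simps)
  also have "norm \<dots> = norm x * inverse (norm (1 + x))" by (simp add: norm_mult norm_inverse)
  also have "\<dots> \<le> q ^ N * inverse (1/2)"
    by (intro mult_mono x le_imp_inverse_le x1) (use q in auto)
  finally show ?thesis by simp
qed

text \<open>Quantitative form of the fact that the Cayley transform (w - 1)/(w + 1) maps the right
  half-plane to the unit disc. It both locates the zeros of the denominator and gives the rate of
  convergence.\<close>

lemma norm_cayley_diff: "norm (w + 1) ^ 2 - norm (w - 1) ^ 2 = 4 * Re w" for w :: complex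
  unfolding cmod_power2 by (simp add: power2_eq_square algebra_simps)

text \<open>The half-plane indicator is the limit of \<open>(w + 1)^n / ((w + 1)^n + (w - 1)^n)\<close>
  with \<open>w = e * z\<close> and \<open>n\<close> even: the denominator vanishes only for nonzero imaginary \<open>w\<close>.\<close>

lemma half_plane_indicator_in_poly_closure:
  assumes K: "compact K" and e: "\<And>z. z \<in> K \<Longrightarrow> Re (e * z) \<noteq> 0"
  shows "(\<lambda>z. if Re (e * z) > 0 then 1 else 0) \<in> poly_closure K"
proof (cases "K = {}")
  case True
  then show ?thesis using const_in_closure[of undefined K] by (auto simp: poly_closure_def uniform_closure_def)
next
  case False
  have "continuous_on K (\<lambda>z. \<bar>Re (e * z)\<bar>)" by (intro continuous_intros)
  from continuous_attains_inf[OF K False this] obtain z0 where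
    z0: "z0 \<in> K" "\<And>z. z \<in> K \<Longrightarrow> \<bar>Re (e * z0)\<bar> \<le> \<bar>Re (e * z)\<bar>" by auto
  define c where "c = \<bar>Re (e * z0)\<bar>"
  have c: "c > 0" "\<And>z. z \<in> K \<Longrightarrow> c \<le> \<bar>Re (e * z)\<bar>" using z0 e[OF z0(1)] by (auto simp: c_def)
  have "continuous_on K (\<lambda>z. norm (e * z))" by (intro continuous_intros)
  from continuous_attains_sup[OF K False this] obtain z1 where
    z1: "z1 \<in> K" "\<And>z. z \<in> K \<Longrightarrow> norm (e * z) \<le> norm (e * z1)" by auto
  define R where "R = norm (e * z1)"
  have R: "\<And>z. z \<in> K \<Longrightarrow> norm (e * z) \<le> R" using z1 by (auto simp: R_def)
  have cR: "c \<le> R" using z0(1) R[OF z0(1)] abs_Re_le_cmod[of "e * z0"] by (simp add: c_def)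
  \<comment> \<open>The squared norms of ez + 1 and ez - 1 differ by at least 4c, and neither norm
    exceeds R + 1; so the ratio of the smaller square to the larger is at most \<open>q\<close>.
    Nonnegativity of \<open>q\<close> comes from (R - 1)^2 \<ge> 0 and c \<le> R.\<close>
  define q where "q = 1 - 4 * c / (R + 1)^2"
  have "4 * R \<le> (R + 1)^2" using zero_le_power2[of "R - 1"] by (simp add: power2_eq_square algebra_simps)
  then have q: "0 \<le> q" "q < 1" using c(1) cR by (auto simp: q_def divide_simps)
  \<comment> \<open>Stated for abstract \<open>a\<close> and \<open>b\<close>, since the two
    half-planes exchange their roles.\<close>
  have key: "norm b ^ 2 \<le> q * norm a ^ 2 \<and> a \<noteq> 0"
    if "norm a ^ 2 - norm b ^ 2 \<ge> 4 * c" "norm a \<le> R + 1" for a b :: complex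
  proof
    have "norm a ^ 2 \<le> (R + 1)^2" using that(2) by (intro power_mono) auto
    then have "4 * c / (R + 1)^2 * norm a ^ 2 \<le> 4 * c / (R + 1)^2 * (R + 1)^2"
      using c(1) by (intro mult_left_mono) auto
    also have "\<dots> = 4 * c" using cR c(1) by simp
    finally show "norm b ^ 2 \<le> q * norm a ^ 2" using that(1) by (simp add: q_def algebra_simps)
    show "a \<noteq> 0" using that(1) c(1) zero_le_power2[of "norm b"] by (smt (verit) norm_zero power_zero_numeral)
  qed
  show ?thesis
    unfolding poly_closure_def
  proof (rule uniform_closure_limit, fold poly_closure_def)
    fix \<epsilon> :: real assume \<epsilon>: "\<epsilon> > 0"
    have "\<forall>\<^sub>F N in sequentially. q ^ N < min (1/2) (\<epsilon>/2)"
      by (rule order_tendstoD[OF LIMSEQ_power_zero]) (use q \<epsilon> in auto)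
    then obtain N where N: "q ^ N < min (1/2) (\<epsilon>/2)" by (auto simp: eventually_sequentially)
    define p where "p = [:1, e:] ^ (2*N) + [:-1, e:] ^ (2*N)"
    have p: "poly p z = (e * z + 1) ^ (2*N) + (e * z - 1) ^ (2*N)" for z
      by (simp add: p_def algebra_simps)
    \<comment> \<open>For t = 0 or N = 0 the value is 2, because the exponent 2N is even. Otherwise
      a zero forces |w + 1| = |w - 1|, hence t Re(ez) = 0.\<close>
    have p_nz: "poly p (of_real t * z) \<noteq> 0" if z: "z \<in> K" for t :: real and z
    proof -
      let ?w = "e * (of_real t * z)"
      show ?thesis
      proof (cases "t = 0 \<or> N = 0")
        case True
        then show ?thesis by (auto simp: p)
      next
        case False
        show ?thesis
        proof
          assume "poly p (of_real t * z) = 0"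
          then have "(?w + 1) ^ (2*N) = - ((?w - 1) ^ (2*N))" by (simp add: p eq_neg_iff_add_eq_0)
          from arg_cong[OF this, of norm] have "norm (?w + 1) ^ (2*N) = norm (?w - 1) ^ (2*N)"
            by (simp only: norm_minus_cancel norm_power)
          then have "norm (?w + 1) = norm (?w - 1)"
            by (rule power_eq_imp_eq_base) (use False in simp_all)
          then have "Re ?w = 0" using norm_cayley_diff[of ?w] by simp
          then show False using e[OF z] False by (simp add: algebra_simps)
        qed
      qed
    qed
    have inv: "(\<lambda>z. inverse (poly p z)) \<in> poly_closure K"
      by (intro poly_closure_inverse K p_nz)
    define g where "g = (\<lambda>z. poly ([:1, e:] ^ (2*N)) z * inverse (poly p z))"
    have "g \<in> poly_closure K" unfolding g_def by (intro poly_closure_mult K poly_in_closure inv)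
    moreover have "norm (g z - (if Re (e * z) > 0 then 1 else 0)) < \<epsilon>" if z: "z \<in> K" for z
    proof -
      let ?a = "e * z + 1" and ?b = "e * z - 1"
      have ab: "norm ?a \<le> R + 1" "norm ?b \<le> R + 1"
        using norm_triangle_ineq[of "e * z" 1] norm_triangle_ineq4[of "e * z" 1] R[OF z] by auto
      have g: "g z = ?a ^ (2*N) * inverse (?a ^ (2*N) + ?b ^ (2*N))"
        by (simp add: g_def p algebra_simps)
      have p0: "?a ^ (2*N) + ?b ^ (2*N) \<noteq> 0"
        using p_nz[OF z, of 1] by (simp add: p)
      show ?thesis
      proof (cases "Re (e * z) > 0")
        case True
        then have "norm ?b ^ 2 \<le> q * norm ?a ^ 2 \<and> ?a \<noteq> 0"
          using c(2)[OF z] norm_cayley_diff[of "e * z"] ab by (intro key) auto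
        then have *: "norm (?b ^ (2*N) * inverse (?a ^ (2*N) + ?b ^ (2*N))) \<le> 2 * q ^ N"
          and a: "?a \<noteq> 0" using N q by (auto intro!: ratio_power_bound)
        have "g z - 1 = - (?b ^ (2*N) * inverse (?a ^ (2*N) + ?b ^ (2*N)))"
          using p0 by (simp add: g divide_simps)
        then have "norm (g z - 1) = norm (?b ^ (2*N) * inverse (?a ^ (2*N) + ?b ^ (2*N)))"
          by (simp only: norm_minus_cancel)
        then show ?thesis using * N True by simp
      next
        case False
        then have "norm ?a ^ 2 \<le> q * norm ?b ^ 2 \<and> ?b \<noteq> 0"
          using c(2)[OF z] norm_cayley_diff[of "e * z"] ab by (intro key) auto
        then have "norm (?a ^ (2*N) * inverse (?b ^ (2*N) + ?a ^ (2*N))) \<le> 2 * q ^ N"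
          using N q by (intro ratio_power_bound) auto
        then show ?thesis using False N by (simp add: g add.commute)
      qed
    qed
    ultimately show "\<exists>g\<in>poly_closure K. \<forall>z\<in>K. norm (g z - (if Re (e * z) > 0 then 1 else 0)) < \<epsilon>"
      by blast
  qed
qed

text \<open>As \<open>y\<close> is not on the ray of \<open>x\<close>, Cauchy-Schwarz is strict, and
  sgn x - sgn y pairs positively with \<open>x\<close> and negatively with \<open>y\<close>. Such
  vectors form a nonempty open set, which cannot be covered by the finitely many null lines
  orthogonal to points of \<open>C\<close>.\<close>

lemma separating_functional:
  fixes x y :: complex
  assumes x: "x \<noteq> 0" and y: "y \<noteq> 0" and xy: "\<not> (\<exists>t>0. y = of_real t * x)"
    and C: "finite C" "0 \<notin> C"
  shows "\<exists>e. Re (e * x) > 0 \<and> Re (e * y) < 0 \<and> (\<forall>c\<in>C. Re (e * c) \<noteq> 0)"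
proof -
  define u where "u = sgn x - sgn y"
  have lt: "x \<bullet> y < norm x * norm y"
  proof (rule ccontr)
    assume "\<not> ?thesis"
    then have "x \<bullet> y = norm x * norm y" using norm_cauchy_schwarz[of x y] by simp
    then have "norm x *\<^sub>R y = norm y *\<^sub>R x" by (simp add: norm_cauchy_schwarz_eq)
    then have "y = of_real (norm y / norm x) * x"
      using x by (simp add: scaleR_conv_of_real field_simps)
    then show False using xy x y by (metis divide_pos_pos zero_less_norm_iff)
  qed
  have "u \<bullet> x = norm x - (x \<bullet> y) / norm y" "u \<bullet> y = (x \<bullet> y) / norm x - norm y"
    using x y by (simp_all add: u_def inner_diff_left sgn_div_norm dot_square_norm power2_eq_square inner_commute[of y x] divide_inverse mult.commute)
  moreover have "(x \<bullet> y) / norm y < norm x" "(x \<bullet> y) / norm x < norm y"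
    using lt x y by (simp_all add: divide_simps mult.commute)
  ultimately have ux: "u \<bullet> x > 0" and uy: "u \<bullet> y < 0"
    by simp_all
  define U where "U = {v. v \<bullet> x > 0} \<inter> {v. v \<bullet> y < 0}"
  have "open U" unfolding U_def
    by (intro open_Int open_Collect_less continuous_intros)
  moreover have "u \<in> U" using ux uy by (simp add: U_def)
  ultimately have "\<not> negligible U" using open_not_negligible by blast
  moreover have "negligible (\<Union>c\<in>C. {v. c \<bullet> v = 0})"
    using C by (intro negligible_Union) (auto intro!: negligible_hyperplane)
  ultimately have "\<not> U \<subseteq> (\<Union>c\<in>C. {v. c \<bullet> v = 0})" using negligible_subset by blast
  then obtain v where v: "v \<in> U" "\<And>c. c \<in> C \<Longrightarrow> c \<bullet> v \<noteq> 0" by auto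
  have "Re (cnj v * z) = v \<bullet> z" for z by (simp add: inner_complex_def)
  then show ?thesis using v by (intro exI[of _ "cnj v"]) (auto simp: U_def inner_commute)
qed

text \<open>The indicator is a finite product of half-plane indicators: each competing direction is
  cut off by a half-plane that contains \<open>x\<close> and whose boundary meets none of the rays
  carrying \<open>K\<close>.\<close>

lemma ray_indicator_in_poly_closure:
  assumes K: "compact K" "0 \<notin> K" and C: "finite C" 
    and KC: "\<And>z. z \<in> K \<Longrightarrow> \<exists>c\<in>C. \<exists>t::real. z = of_real t * c" and x: "x \<noteq> 0"
  shows "(\<lambda>z. if \<exists>t>0. z = of_real t * x then 1 else 0) \<in> poly_closure K"
proof -
  \<comment> \<open>A line through 0 consists of two opposite rays, so both signs of each generator
    are listed.\<close>
  define Y where "Y = (C \<union> uminus ` C) - {0}"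
  have Y: "finite Y" using C by (simp add: Y_def)
  have KY: "\<exists>y\<in>Y. \<exists>t>0. z = of_real t * y" if z: "z \<in> K" for z
  proof -
    obtain c t where ct: "c \<in> C" "z = of_real t * c" using KC[OF z] by blast
    have "z \<noteq> 0" using z K by blast
    then have "t \<noteq> 0" "c \<noteq> 0" using ct by auto
    show ?thesis
    proof (cases "t > 0")
      case True
      then show ?thesis using ct \<open>c \<noteq> 0\<close> by (auto simp: Y_def)
    next
      case False
      then show ?thesis using ct \<open>c \<noteq> 0\<close> \<open>t \<noteq> 0\<close> 
        by (intro bexI[of _ "-c"] exI[of _ "-t"]) (auto simp: Y_def)
    qed
  qed
  define Y' where "Y' = {y \<in> Y. \<not> (\<exists>t>0. y = of_real t * x)}"
  have "\<exists>e. Re (e * x) > 0 \<and> Re (e * y) < 0 \<and> (\<forall>c\<in>Y. Re (e * c) \<noteq> 0)" if "y \<in> Y'" for y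
    using that x Y by (intro separating_functional) (auto simp: Y'_def Y_def)
  then obtain e where e: "\<And>y. y \<in> Y' \<Longrightarrow> Re (e y * x) > 0" "\<And>y. y \<in> Y' \<Longrightarrow> Re (e y * y) < 0"
      "\<And>y c. y \<in> Y' \<Longrightarrow> c \<in> Y \<Longrightarrow> Re (e y * c) \<noteq> 0"
    by metis
  have R: "Re (d * (of_real t * z)) = t * Re (d * z)" for t d z
    by (simp add: algebra_simps)
  have "(\<lambda>z. \<Prod>y\<in>Y'. if Re (e y * z) > 0 then 1 else 0) \<in> poly_closure K"
  proof (intro poly_closure_prod K half_plane_indicator_in_poly_closure)
    fix y z assume y: "y \<in> Y'" and z: "z \<in> K"
    obtain c t where c: "c \<in> Y" "t > 0" "z = of_real t * c" using KY[OF z] by blast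
    then show "Re (e y * z) \<noteq> 0" using e(3)[OF y c(1)] unfolding c(3) R by simp
  qed
  then show ?thesis unfolding poly_closure_def
  proof (rule uniform_closure_cong)
    fix z assume z: "z \<in> K"
    show "(\<Prod>y\<in>Y'. if Re (e y * z) > 0 then 1 else (0::complex)) = (if \<exists>t>0. z = of_real t * x then 1 else 0)"
    proof (cases "\<exists>t>0. z = of_real t * x")
      case True
      then obtain t where t: "t > 0" "z = of_real t * x" by blast
      then have "Re (e y * z) > 0" if "y \<in> Y'" for y
        using e(1)[OF that] unfolding t(2) R by simp
      then show ?thesis using True by (auto intro!: prod.neutral)
    next
      case False
      obtain y t where y: "y \<in> Y" "t > 0" "z = of_real t * y" using KY[OF z] by blast
      \<comment> \<open>The ray through \<open>z\<close> is not that of \<open>x\<close>, so the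
        factor belonging to its own direction vanishes at \<open>z\<close>.\<close>
      have "y \<in> Y'" unfolding Y'_def
      proof (intro CollectI conjI y(1) notI)
        assume "\<exists>s>0. y = of_real s * x"
        then obtain s where "s > 0" "y = of_real s * x" by blast
        then have "z = of_real (t * s) * x" "t * s > 0" using y by auto
        then show False using False by blast
      qed
      moreover from this have "\<not> Re (e y * z) > 0" using e(2)[of y] y(2) unfolding y(3) R 
        by (simp add: zero_less_mult_iff)
      ultimately show ?thesis using False Y by (auto simp: Y'_def prod_zero_iff)
    qed
  qed
qed

text \<open>Polynomials are not closed under conjugation, so the real Stone-Weierstrass theorem is
  applied to the real-valued members of the closure; real and imaginary parts of \<open>f\<close>
  are then treated separately.\<close>

theorem poly_dense_on_lines:
  assumes K: "compact K" "0 \<notin> K" and C: "finite C" 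
    and KC: "\<And>z. z \<in> K \<Longrightarrow> \<exists>c\<in>C. \<exists>t::real. z = of_real t * c"
    and f: "continuous_on K f"
  shows "f \<in> poly_closure K"
proof -
  interpret function_subspace "poly_closure K" by (rule poly_closure_subspace)
  define ray where "ray = (\<lambda>x z. if \<exists>t>0. z = complex_of_real t * x then 1 else (0::real))"
  have ray: "(\<lambda>z. of_real (ray x z)) \<in> poly_closure K" if "x \<noteq> 0" for x
    using ray_indicator_in_poly_closure[OF K C KC that] by (simp add: ray_def if_distrib cong: if_cong)
  define R where "R = {g. (\<lambda>z. complex_of_real (g z)) \<in> poly_closure K}"
  interpret R: function_ring_on R K
  proof
    show "compact K" by (rule K)
    show "continuous_on K g" if "g \<in> R" for g
      using continuous_on_Re[OF poly_closure_continuous, of "\<lambda>z. of_real (g z)" K] that by (simp add: R_def)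
    show "(\<lambda>x. g x + h x) \<in> R" if "g \<in> R" "h \<in> R" for g h
      using that by (simp add: R_def add)
    show "(\<lambda>x. g x * h x) \<in> R" if "g \<in> R" "h \<in> R" for g h
      using that by (simp add: R_def poly_closure_mult K)
    show "(\<lambda>_. c) \<in> R" for c by (simp add: R_def const_in_closure)
    fix x y assume xy: "x \<in> K" "y \<in> K" "x \<noteq> y"
    have x: "x \<noteq> 0" using xy K by auto
    show "\<exists>g\<in>R. g x \<noteq> g y"
    proof (cases "\<exists>t>0. y = of_real t * x")
      case True
      then obtain t where t: "t > 0" "y = of_real t * x" by blast
      \<comment> \<open>Two points of one ray are separated by the coordinate z/x. Multiplying by
        the ray indicator makes it real on all of \<open>K\<close>.\<close>
      have "(\<lambda>z. of_real (ray x z) * (z * inverse x)) \<in> poly_closure K"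
        using poly_in_closure[of "[:0,1:]" K]
        by (intro poly_closure_mult K ray x const_in_closure) simp
      moreover have "of_real (ray x z) * (z * inverse x) = of_real (ray x z * Re (z * inverse x))" for z
      proof (cases "\<exists>s>0. z = complex_of_real s * x")
        case True
        then obtain s where "z * inverse x = complex_of_real s" using x by (auto simp: mult.assoc)
        then show ?thesis by (simp only: Re_complex_of_real of_real_mult)
      next
        case False
        then have "ray x z = 0" by (auto simp: ray_def)
        then show ?thesis by simp
      qed
      ultimately have "(\<lambda>z. ray x z * Re (z * inverse x)) \<in> R" by (simp add: R_def)
      moreover have "ray x x = 1" "ray x y = 1"
        using t True exI[of "\<lambda>s. 0 < s \<and> x = complex_of_real s * x" 1] by (auto simp: ray_def)
      moreover have "x * inverse x = 1" "y * inverse x = of_real t"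
        using x t by (auto simp: mult.assoc)
      then have "Re (x * inverse x) = 1" "Re (y * inverse x) = t"
        by (simp_all only: Re_complex_of_real one_complex.sel)
      moreover have "t \<noteq> 1" using t xy by auto
      ultimately show ?thesis by (intro bexI[of _ "\<lambda>z. ray x z * Re (z * inverse x)"]) auto
    next
      case False
      moreover have "\<exists>t>0. x = complex_of_real t * x" by (intro exI[of _ 1]) auto
      ultimately have "ray x x = 1" "ray x y = 0" by (auto simp: ray_def)
      moreover have "ray x \<in> R" using ray[OF x] by (simp add: R_def)
      ultimately show ?thesis by (intro bexI[of _ "ray x"]) auto
    qed
  qed
  have *: "(\<lambda>z. of_real (g z)) \<in> poly_closure K" if g: "continuous_on K g" for g
    unfolding poly_closure_def
  proof (rule uniform_closure_limit, fold poly_closure_def)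
    fix e :: real assume "e > 0"
    then obtain h where h: "h \<in> R" "\<forall>x\<in>K. \<bar>g x - h x\<bar> < e" using R.Stone_Weierstrass_basic[OF g] by blast
    then have "\<forall>z\<in>K. norm (complex_of_real (h z) - complex_of_real (g z)) < e"
      by (metis abs_minus_commute norm_of_real of_real_diff)
    then show "\<exists>h\<in>poly_closure K. \<forall>z\<in>K. norm (h z - complex_of_real (g z)) < e"
      using h(1) by (auto simp: R_def)
  qed
  have "(\<lambda>z. of_real (Re (f z)) + \<i> * of_real (Im (f z))) \<in> poly_closure K"
    by (intro add poly_closure_mult K const_in_closure * continuous_intros f)
  then show ?thesis by (simp flip: complex_eq)
qed

subsection \<open>Density of the polynomial states\<close>

lemma matpow_scaleR: "matpow (c *\<^sub>R A) k = c ^ k *\<^sub>R matpow A k" for A :: "real ^ 'n ^ 'n"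
proof (induction k)
  case (Suc k)
  then show ?case
    by (simp add: matrix_matrix_mult_def vec_eq_iff sum_distrib_left mult_ac)
qed simp

lemma matpow_Suc_vec: "matpow A (Suc k) *v v = A *v (matpow A k *v v)"
  by (simp add: matrix_vector_mul_assoc)

text \<open>These are the discrete-time reachable functions with the input read backwards, so that
  \<open>w k\<close> meets the k-th power; see \<open>poly_states_eq_dt\<close>.\<close>

definition poly_states :: "real ^ 'n ^ 'n \<Rightarrow> real ^ 'm ^ 'n \<Rightarrow> (real \<Rightarrow> real ^ 'n) set" where
  "poly_states A B =
     {\<lambda>\<theta>. \<Sum>k<T. \<theta> ^ k *\<^sub>R (matpow A k *v (B *v w k)) | (T::nat) w. T > 0}"

lemma poly_states_subspace: "function_subspace (poly_states A B)"
proof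
  show "(\<lambda>x. 0) \<in> poly_states A B"
    unfolding poly_states_def by (intro CollectI exI[of _ 1] exI[of _ "\<lambda>_. 0"]) auto
  show "(\<lambda>x. c *\<^sub>R f x) \<in> poly_states A B" if f: "f \<in> poly_states A B" for f c
  proof -
    obtain T w where f: "T > 0" "f = (\<lambda>\<theta>. \<Sum>k<T. \<theta> ^ k *\<^sub>R (matpow A k *v (B *v w k)))"
      using f unfolding poly_states_def by blast
    show ?thesis unfolding poly_states_def f(2) using f(1)
      by (intro CollectI exI[of _ T] exI[of _ "\<lambda>k. c *\<^sub>R w k"])
         (auto simp: scaleR_sum_right matrix_vector_mult_scaleR mult.commute)
  qed
  show "(\<lambda>x. f x + g x) \<in> poly_states A B" if f: "f \<in> poly_states A B" and g: "g \<in> poly_states A B" for f g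
  proof -
    obtain T w where f: "T > 0" "f = (\<lambda>\<theta>. \<Sum>k<T. \<theta> ^ k *\<^sub>R (matpow A k *v (B *v w k)))"
      using f unfolding poly_states_def by blast
    obtain U v where g: "U > 0" "g = (\<lambda>\<theta>. \<Sum>k<U. \<theta> ^ k *\<^sub>R (matpow A k *v (B *v v k)))"
      using g unfolding poly_states_def by blast
    \<comment> \<open>Zero inputs extend both sums to the common length T + U.\<close>
    have pad: "(\<Sum>k<T. \<theta> ^ k *\<^sub>R (matpow A k *v (B *v w k))) =
        (\<Sum>k<N. \<theta> ^ k *\<^sub>R (matpow A k *v (B *v (if k < T then w k else 0))))"
      if "T \<le> N" for T N :: nat and \<theta> :: real and w
      using that by (intro sum.mono_neutral_cong_left) auto
    have "(\<lambda>\<theta>. f \<theta> + g \<theta>) = (\<lambda>\<theta>. \<Sum>k<T+U. \<theta> ^ k *\<^sub>R (matpow A k *v (B *v 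
        ((if k < T then w k else 0) + (if k < U then v k else 0)))))"
      unfolding f(2) g(2) pad[of T "T+U", OF le_add1] pad[of U "T+U", OF le_add2]
      by (simp only: sum.distrib matrix_vector_right_distrib scaleR_add_right)
    then show ?thesis unfolding poly_states_def using f(1) 
      by (intro CollectI exI[of _ "T+U"]) auto
  qed
qed

text \<open>For real \<theta> this is the real part of p(\<theta>A)Bw; only real parts of
  coefficients occur because inputs are real.\<close>

lemma poly_in_poly_states:
  "(\<lambda>\<theta>. \<Sum>k\<le>degree p. (Re (coeff p k) * \<theta> ^ k) *\<^sub>R (matpow A k *v (B *v w))) \<in> poly_states A B"
  unfolding poly_states_def
  by (intro CollectI exI[of _ "Suc (degree p)"] exI[of _ "\<lambda>k. Re (coeff p k) *\<^sub>R w"])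
     (auto simp: matrix_vector_mult_scaleR lessThan_Suc_atMost mult.commute)

lemma controllable_decompose:
  fixes A :: "real ^ 'n ^ 'n" and B :: "real ^ 'm ^ 'n"
  assumes "controllable A B"
  obtains w where "b = (\<Sum>k\<in>(UNIV :: 'n set). matpow A (to_nat_on UNIV k) *v (B *v w k))"
proof -
  have "surj ((*v) (kalman_matrix A B))"
    using assms unfolding controllable_def full_rank_surjective .
  then obtain x where x: "b = kalman_matrix A B *v x" by (metis surjD)
  have "b = (\<Sum>k\<in>UNIV. matpow A (to_nat_on UNIV k) *v (B *v (\<chi> j. x $ (k, j))))"
  proof (unfold x vec_eq_iff, rule allI)
    fix i
    have "(kalman_matrix A B *v x) $ i = (\<Sum>kj\<in>UNIV. kalman_matrix A B $ i $ kj * x $ kj)"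
      by (simp add: matrix_vector_mult_def)
    then have "(kalman_matrix A B *v x) $ i =
        (\<Sum>(k, j)\<in>UNIV \<times> UNIV. (matpow A (to_nat_on UNIV k) ** B) $ i $ j * x $ (k, j))"
      by (simp add: kalman_matrix_def case_prod_beta)
    then show "(kalman_matrix A B *v x) $ i =
        (\<Sum>k\<in>UNIV. matpow A (to_nat_on UNIV k) *v (B *v (\<chi> j. x $ (k, j)))) $ i"
      unfolding sum.cartesian_product[symmetric]
      by (simp add: matrix_vector_mul_assoc matrix_vector_mult_def[of "_ ** _"])
  qed
  then show ?thesis by (rule that[of "\<lambda>k. \<chi> j. x $ (k, j)"])
qed

text \<open>If A = S D S^-1, the rows of S^-1 are left eigenvectors and yield the coordinate
  functionals \<open>y i\<close>, while the columns of S are right eigenvectors and yield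
  \<open>s\<close>. The index runs over \<open>'n\<close>, so eigenvalues \<open>d i\<close> repeat
  with multiplicity.\<close>

lemma spectral_coordinates:
  fixes A :: "real ^ 'n ^ 'n"
  assumes "diagonalizable (complex_matrix A)"
  obtains y :: "'n \<Rightarrow> real ^ 'n \<Rightarrow> complex" and s :: "'n \<Rightarrow> 'n \<Rightarrow> complex" and d :: "'n \<Rightarrow> complex"
  where "\<And>i v w. y i (v + w) = y i v + y i w" 
    "\<And>i c v. y i (c *\<^sub>R v) = of_real c * y i v"
    "\<And>i v. y i (A *v v) = d i * y i v"
    "\<And>j v. of_real (v $ j) = (\<Sum>i\<in>UNIV. s j i * y i v)"
    "\<And>i. \<exists>v. y i v \<noteq> 0"
    "\<And>i. d i \<in> eigenvalues (complex_matrix A)"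
proof -
  let ?A = "complex_matrix A"
  obtain S D :: "complex ^ 'n ^ 'n" where S: "invertible S" and D: "\<And>i j. i \<noteq> j \<Longrightarrow> D $ i $ j = 0"
      and A: "?A = S ** D ** matrix_inv S"
    using assms unfolding diagonalizable_def by blast
  define L where "L = matrix_inv S"
  have SL: "S ** L = mat 1" "L ** S = mat 1"
    using someI_ex[OF S[unfolded invertible_def]] by (auto simp: L_def matrix_inv_def)
  have AS: "?A ** S = S ** D" unfolding A L_def[symmetric] by (simp add: SL flip: matrix_mul_assoc)
  have LA: "L ** ?A = D ** L" unfolding A L_def[symmetric] by (simp add: SL matrix_mul_assoc)
  define cv :: "real ^ 'n \<Rightarrow> complex ^ 'n" where "cv = (\<lambda>v. \<chi> j. of_real (v $ j))"
  define y where "y = (\<lambda>i v. (L *v cv v) $ i)"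
  have sumD: "(\<Sum>k\<in>UNIV. a k * D $ k $ i) = a i * D $ i $ i" for a i
    using D by (subst sum.remove[of _ i]) (auto intro!: sum.neutral)
  have sumD': "(\<Sum>k\<in>UNIV. D $ i $ k * a k) = D $ i $ i * a i" for a i
    using D by (subst sum.remove[of _ i]) (auto intro!: sum.neutral)
  \<comment> \<open>This diagonal identity shows that row i of \<open>L\<close> and column i of
    \<open>S\<close> are both nonzero, so \<open>y i\<close> does not vanish and column i is an
    eigenvector.\<close>
  have LS1: "(\<Sum>k\<in>UNIV. L $ i $ k * S $ k $ i) = 1" for i
    using SL(2) by (simp add: vec_eq_iff matrix_matrix_mult_def mat_def)
  show ?thesis
  proof (rule that[of y "\<lambda>i. D $ i $ i" "\<lambda>j i. S $ j $ i"])
    show "y i (v + w) = y i v + y i w" for i v w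
      by (simp add: y_def cv_def matrix_vector_mult_def algebra_simps sum.distrib)
    show "y i (c *\<^sub>R v) = of_real c * y i v" for i c v
      by (simp add: y_def cv_def matrix_vector_mult_def sum_distrib_left mult_ac)
    show "y i (A *v v) = D $ i $ i * y i v" for i v
    proof -
      have "cv (A *v v) = ?A *v cv v"
        by (simp add: cv_def vec_eq_iff matrix_vector_mult_def map_matrix_def)
      then have "y i (A *v v) = (D *v (L *v cv v)) $ i"
        by (simp add: y_def matrix_vector_mul_assoc LA)
      then show ?thesis by (simp add: matrix_vector_mult_def[of D] sumD' y_def)
    qed
    show "of_real (v $ j) = (\<Sum>i\<in>UNIV. S $ j $ i * y i v)" for j v
    proof -
      have "S *v (L *v cv v) = cv v" by (simp add: matrix_vector_mul_assoc SL)
      then show ?thesis by (simp add: y_def vec_eq_iff cv_def matrix_vector_mult_def[of S])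
    qed
    show "\<exists>v. y i v \<noteq> 0" for i
    proof -
      have "\<exists>k. L $ i $ k \<noteq> 0"
      proof (rule ccontr)
        assume "\<nexists>k. L $ i $ k \<noteq> 0"
        then show False using LS1[of i] by simp
      qed
      then obtain k where k: "L $ i $ k \<noteq> 0" ..
      have "y i (axis k 1) = L $ i $ k"
        by (simp add: y_def cv_def matrix_vector_mult_def axis_def if_distrib cong: if_cong)
      with k show ?thesis by (intro exI[of _ "axis k 1"]) simp
    qed
    show "D $ i $ i \<in> eigenvalues ?A" for i
      unfolding eigenvalues_def
    proof (intro CollectI exI[of _ "column i S"] conjI)
      show "column i S \<noteq> 0"
      proof
        assume "column i S = 0"
        then have "S $ k $ i = 0" for k by (simp add: column_def vec_eq_iff)
        then show False using LS1[of i] by simp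
      qed
      have "(?A *v column i S) $ j = (?A ** S) $ j $ i" for j
        by (simp add: matrix_vector_mult_def matrix_matrix_mult_def column_def)
      also have "\<dots> j = (D $ i $ i *s column i S) $ j" for j
        unfolding AS by (simp add: matrix_matrix_mult_def sumD column_def mult.commute[of "S $ j $ i"])
      finally show "?A *v column i S = D $ i $ i *s column i S" by (simp add: vec_eq_iff)
    qed
  qed
qed

text \<open>Functions g(\<theta>) times the spectral projection of b are approximated first for b =
  Bw, then for b = A^k B w, then by controllability for every b. Since the projections sum to the
  identity, any continuous target is a finite sum of such functions.\<close>

theorem poly_states_dense:
  fixes A :: "real ^ 'n ^ 'n" and B :: "real ^ 'm ^ 'n"
  assumes P: "compact P" "0 \<notin> P" and ctrl: "controllable A B" and inv: "invertible A"
    and diag: "diagonalizable (complex_matrix A)"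
    and disj: "\<And>\<nu> \<mu>. \<nu> \<in> eigenvalues (complex_matrix A) \<Longrightarrow> \<mu> \<in> eigenvalues (complex_matrix A) \<Longrightarrow>
      \<nu> \<noteq> \<mu> \<Longrightarrow> scaled_set \<nu> P \<inter> scaled_set \<mu> P = {}"
    and x: "continuous_on P x"
  shows "x \<in> uniform_closure P (poly_states A B)"
proof -
  obtain y :: "'n \<Rightarrow> real ^ 'n \<Rightarrow> complex" and s :: "'n \<Rightarrow> 'n \<Rightarrow> complex" and d :: "'n \<Rightarrow> complex"
    where y_add: "\<And>i v w. y i (v + w) = y i v + y i w" 
    and y_scale: "\<And>i c v. y i (c *\<^sub>R v) = of_real c * y i v"
    and y_A: "\<And>i v. y i (A *v v) = d i * y i v"
    and y_sum: "\<And>j v. of_real (v $ j) = (\<Sum>i\<in>UNIV. s j i * y i v)"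
    and y_nz: "\<And>i. \<exists>v. y i v \<noteq> 0"
    and d_ev: "\<And>i::'n. d i \<in> eigenvalues (complex_matrix A)"
    by (rule spectral_coordinates[OF diag]) (rule that)
  have y_A_pow: "y i (matpow A k *v v) = d i ^ k * y i v" for i k v
    by (induction k) (simp_all add: matpow_Suc_vec y_A del: matpow.simps(2))
  \<comment> \<open>A zero eigenvalue would make \<open>y i\<close> vanish on the range of
    \<open>A\<close>, which is the whole space.\<close>
  have d0: "d i \<noteq> 0" for i
  proof
    assume "d i = 0"
    obtain A' where "A ** A' = mat 1" using inv unfolding invertible_def by blast
    then have "v = A *v (A' *v v)" for v by (simp add: matrix_vector_mul_assoc)
    then have "y i v = 0" for v using y_A[of i "A' *v v"] \<open>d i = 0\<close> by simp
    then show False using y_nz[of i] by simp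
  qed
  interpret V: function_subspace "uniform_closure P (poly_states A B)"
    by (rule function_subspace.closure_subspace[OF poly_states_subspace])
  define K where "K = (\<Union>i. scaled_set (d i) P)"
  have compS: "compact (scaled_set \<mu> P)" for \<mu>
    unfolding scaled_set_def by (intro compact_continuous_image P continuous_intros)
  have K: "compact K" unfolding K_def by (intro compact_UN compS) auto
  have K0: "0 \<notin> K" using P(2) d0 by (auto simp: K_def scaled_set_def)
  have KL: "\<exists>c\<in>range d. \<exists>t::real. z = of_real t * c" if "z \<in> K" for z
    using that by (auto simp: K_def scaled_set_def mult.commute)
  \<comment> \<open>\<open>E \<mu> g b\<close> is the real part of \<open>g\<close> times the
    projection of \<open>b\<close> to the eigenspace of \<mu>; both factors may be complex.\<close>
  define E where "E = (\<lambda>\<mu> g b (\<theta>::real). \<chi> j. Re (g \<theta> * (\<Sum>i | d i = \<mu>. s j i * y i b)))"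
  have step1: "E \<mu> g (B *v w) \<in> uniform_closure P (poly_states A B)"
    if \<mu>: "\<mu> \<in> range d" and g: "continuous_on P g" for \<mu> g w
  proof (rule uniform_closureI)
    fix e :: real assume e: "e > 0"
    define b where "b = B *v w"
    have \<mu>0: "\<mu> \<noteq> 0" and \<mu>ev: "\<mu> \<in> eigenvalues (complex_matrix A)" using \<mu> d0 d_ev by auto
    \<comment> \<open>The scalar function that p should approximate on \<open>K\<close>:
      \<open>g\<close> transported to \<mu>P, and 0 on the pieces of the other eigenvalues.
      Disjointness of the scaled sets makes this continuous.\<close>
    define f where "f = (\<lambda>z. if z \<in> scaled_set \<mu> P then g (Re (z / \<mu>)) else 0)"
    have f_eq: "f (d i * of_real \<theta>) = (if d i = \<mu> then g \<theta> else 0)" if "\<theta> \<in> P" for i \<theta>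
    proof (cases "d i = \<mu>")
      case True
      then show ?thesis using that \<mu>0 by (auto simp: f_def scaled_set_def)
    next
      case False
      have "d i * of_real \<theta> \<in> scaled_set (d i) P" using that unfolding scaled_set_def by (rule imageI)
      then show ?thesis using False disj[OF d_ev \<mu>ev] by (auto simp: f_def)
    qed
    define K2 where "K2 = (\<Union>i\<in>{i. d i \<noteq> \<mu>}. scaled_set (d i) P)"
    have KK: "K = scaled_set \<mu> P \<union> K2" using \<mu> unfolding K_def K2_def by auto metis
    have dj: "scaled_set \<mu> P \<inter> K2 = {}" using disj[OF d_ev \<mu>ev] by (auto simp: K2_def)
    have "continuous_on (scaled_set \<mu> P) (\<lambda>z. g (Re (z / \<mu>)))"
    proof (rule continuous_on_compose2[OF g])
      show "continuous_on (scaled_set \<mu> P) (\<lambda>z. Re (z / \<mu>))" using \<mu>0 by (intro continuous_intros) auto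
      show "(\<lambda>z. Re (z / \<mu>)) ` scaled_set \<mu> P \<subseteq> P" using \<mu>0 by (auto simp: scaled_set_def)
    qed
    then have "continuous_on K f" unfolding f_def KK
      using dj by (intro continuous_on_cases compact_imp_closed compS) 
        (auto simp: K2_def intro!: compact_imp_closed compact_UN compS)
    then have f: "f \<in> poly_closure K"
      by (intro poly_dense_on_lines[OF K K0 _ KL]) auto
    \<comment> \<open>\<open>M\<close> collects the coefficients of all coordinates of the error;
      the added 1 makes \<open>M\<close> positive and the final bound (M - 1) e/M strictly less than
      \<open>e\<close>.\<close>
    define M where "M = (\<Sum>j\<in>UNIV. \<Sum>i\<in>UNIV. norm (s j i * y i b)) + 1"
    have M: "M > 0" unfolding M_def by (intro add_nonneg_pos sum_nonneg) auto
    obtain p where p: "\<And>z. z \<in> K \<Longrightarrow> norm (poly p z - f z) < e / M"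
      using poly_closureE[OF f, of "e / M"] e M by auto
    define F where "F = (\<lambda>\<theta>. \<Sum>k\<le>degree p. (Re (coeff p k) * \<theta> ^ k) *\<^sub>R (matpow A k *v b))"
    have "F \<in> poly_states A B" unfolding F_def b_def by (rule poly_in_poly_states)
    moreover have "norm (F \<theta> - E \<mu> g b \<theta>) < e" if \<theta>: "\<theta> \<in> P" for \<theta>
    proof -
      \<comment> \<open>In spectral coordinates p(\<theta>A) is multiplication by p(d_i
        \<theta>).\<close>
      have F: "F \<theta> $ j = Re (\<Sum>i\<in>UNIV. s j i * y i b * poly p (d i * of_real \<theta>))" for j
      proof -
        have "F \<theta> $ j = (\<Sum>k\<le>degree p. Re (coeff p k) * \<theta> ^ k * (matpow A k *v b) $ j)"
          by (simp add: F_def)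
        also have "\<dots> = Re (\<Sum>k\<le>degree p. coeff p k * of_real \<theta> ^ k * of_real ((matpow A k *v b) $ j))"
          by (simp flip: of_real_power)
        also have "(\<Sum>k\<le>degree p. coeff p k * of_real \<theta> ^ k * of_real ((matpow A k *v b) $ j)) =
            (\<Sum>k\<le>degree p. \<Sum>i\<in>UNIV. s j i * y i b * (coeff p k * (d i * of_real \<theta>) ^ k))"
          unfolding y_sum y_A_pow by (simp add: sum_distrib_left power_mult_distrib mult_ac)
        also have "\<dots> = (\<Sum>i\<in>UNIV. s j i * y i b * poly p (d i * of_real \<theta>))"
          by (subst sum.swap) (simp add: poly_altdef sum_distrib_left)
        finally show ?thesis .
      qed
      have E: "E \<mu> g b \<theta> $ j = Re (\<Sum>i\<in>UNIV. s j i * y i b * f (d i * of_real \<theta>))" for j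
      proof -
        have "(\<Sum>i\<in>UNIV. s j i * y i b * f (d i * of_real \<theta>)) = (\<Sum>i\<in>{i. d i = \<mu>}. s j i * y i b * g \<theta>)"
          using f_eq[OF \<theta>] by (intro sum.mono_neutral_cong_right) auto
        then show ?thesis by (simp add: E_def sum_distrib_left mult_ac)
      qed
      have "\<bar>(F \<theta> - E \<mu> g b \<theta>) $ j\<bar> \<le> (\<Sum>i\<in>UNIV. norm (s j i * y i b)) * (e / M)" for j
      proof -
        have "(F \<theta> - E \<mu> g b \<theta>) $ j = 
            Re (\<Sum>i\<in>UNIV. s j i * y i b * (poly p (d i * of_real \<theta>) - f (d i * of_real \<theta>)))"
          by (simp only: vector_minus_component F E minus_complex.sel(1)[symmetric] sum_subtractf[symmetric] right_diff_distrib)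
        also have "\<bar>\<dots>\<bar> \<le> norm (\<Sum>i\<in>UNIV. s j i * y i b * (poly p (d i * of_real \<theta>) - f (d i * of_real \<theta>)))"
          by (rule abs_Re_le_cmod)
        also have "\<dots> \<le> (\<Sum>i\<in>UNIV. norm (s j i * y i b) * norm (poly p (d i * of_real \<theta>) - f (d i * of_real \<theta>)))"
          by (rule order_trans[OF norm_sum]) (simp add: norm_mult)
        also have "\<dots> \<le> (\<Sum>i\<in>UNIV. norm (s j i * y i b) * (e / M))"
          using \<theta> unfolding K_def scaled_set_def
          by (intro sum_mono mult_left_mono less_imp_le[OF p[unfolded K_def scaled_set_def]] UN_I[OF UNIV_I] imageI) auto
        finally show ?thesis by (simp only: sum_distrib_right)
      qed
      then have "norm (F \<theta> - E \<mu> g b \<theta>) \<le> (\<Sum>j\<in>UNIV. (\<Sum>i\<in>UNIV. norm (s j i * y i b)) * (e / M))"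
        by (intro order_trans[OF norm_le_l1_cart] sum_mono)
      also have "\<dots> = (M - 1) * (e / M)" by (simp only: M_def sum_distrib_right[symmetric]) simp
      also have "\<dots> < e" using M e by (simp add: field_simps)
      finally show ?thesis .
    qed
    ultimately show "\<exists>h\<in>poly_states A B. \<forall>\<theta>\<in>P. norm (h \<theta> - E \<mu> g (B *v w) \<theta>) < e"
      unfolding b_def by blast
  qed
  \<comment> \<open>On the eigenspace of \<mu>, A^k is the scalar \<mu>^k, which is absorbed into
    the complex-valued \<open>g\<close>.\<close>
  have step2: "E \<mu> g (matpow A k *v (B *v w)) \<in> uniform_closure P (poly_states A B)"
    if \<mu>: "\<mu> \<in> range d" and g: "continuous_on P g" for \<mu> g w k
  proof -
    have "(\<Sum>i | d i = \<mu>. s j i * y i (matpow A k *v (B *v w))) = \<mu> ^ k * (\<Sum>i | d i = \<mu>. s j i * y i (B *v w))" for j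
      by (simp add: y_A_pow sum_distrib_left mult_ac)
    then have "E \<mu> g (matpow A k *v (B *v w)) = E \<mu> (\<lambda>\<theta>. g \<theta> * \<mu> ^ k) (B *v w)"
      by (simp only: E_def mult.assoc)
    then show ?thesis using step1[OF \<mu>, of "\<lambda>\<theta>. g \<theta> * \<mu> ^ k"] g by (simp add: continuous_intros)
  qed
  have y_0: "y i 0 = 0" for i using y_scale[of i 0 0] by simp
  have y_sumv: "y i (\<Sum>k\<in>I. v k) = (\<Sum>k\<in>I. y i (v k))" for i v and I :: "'n set"
    by (induction I rule: infinite_finite_induct) (simp_all add: y_0 y_add)
  have step3: "E \<mu> g b \<in> uniform_closure P (poly_states A B)"
    if \<mu>: "\<mu> \<in> range d" and g: "continuous_on P g" for \<mu> g b
  proof -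
    obtain w where b: "b = (\<Sum>k\<in>(UNIV :: 'n set). matpow A (to_nat_on UNIV k) *v (B *v w k))"
      using controllable_decompose[OF ctrl] .
    have "E \<mu> g b = (\<lambda>\<theta>. \<Sum>k\<in>UNIV. E \<mu> g (matpow A (to_nat_on UNIV k) *v (B *v w k)) \<theta>)"
    proof (rule ext, unfold vec_eq_iff, rule allI)
      fix \<theta> j
      define X where "X = (\<lambda>k. \<Sum>i | d i = \<mu>. s j i * y i (matpow A (to_nat_on UNIV k) *v (B *v w k)))"
      have "(\<Sum>i | d i = \<mu>. s j i * y i b) = (\<Sum>k\<in>UNIV. X k)"
        unfolding b y_sumv sum_distrib_left X_def by (rule sum.swap)
      then have "E \<mu> g b \<theta> $ j = Re (g \<theta> * (\<Sum>k\<in>UNIV. X k))"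
        by (simp only: E_def vec_lambda_beta)
      also have "\<dots> = Re (\<Sum>k\<in>UNIV. g \<theta> * X k)"
        by (simp only: sum_distrib_left)
      also have "\<dots> = (\<Sum>k\<in>UNIV. E \<mu> g (matpow A (to_nat_on UNIV k) *v (B *v w k)) \<theta>) $ j"
        by (simp only: E_def vec_lambda_beta sum_component Re_sum X_def)
      finally show "E \<mu> g b \<theta> $ j = (\<Sum>k\<in>UNIV. E \<mu> g (matpow A (to_nat_on UNIV k) *v (B *v w k)) \<theta>) $ j" .
    qed
    then show ?thesis using step2[OF \<mu> g] by (simp add: V.sum)
  qed
  \<comment> \<open>The target is expanded in standard basis vectors, and each basis vector into its
    spectral components.\<close>
  have "(\<lambda>\<theta>. \<Sum>l\<in>UNIV. \<Sum>\<mu>\<in>range d. E \<mu> (\<lambda>\<theta>. of_real (x \<theta> $ l)) (axis l 1) \<theta>) 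
      \<in> uniform_closure P (poly_states A B)"
    using x by (intro V.sum step3 continuous_intros)
  moreover have "(\<Sum>l\<in>UNIV. \<Sum>\<mu>\<in>range d. E \<mu> (\<lambda>\<theta>. of_real (x \<theta> $ l)) (axis l 1) \<theta>) = x \<theta>" for \<theta>
  proof (unfold vec_eq_iff, rule allI)
    fix j
    have "(\<Sum>\<mu>\<in>range d. E \<mu> (\<lambda>\<theta>. of_real (x \<theta> $ l)) (axis l 1) \<theta> $ j) = x \<theta> $ l * axis l 1 $ j" for l
    proof -
      have "(\<Sum>\<mu>\<in>range d. \<Sum>i | d i = \<mu>. s j i * y i (axis l 1)) = of_real (axis l 1 $ j)"
        unfolding y_sum using sum.image_gen[of UNIV "\<lambda>i. s j i * y i (axis l 1)" d] by simp
      then have "(\<Sum>\<mu>\<in>range d. of_real (x \<theta> $ l) * (\<Sum>i | d i = \<mu>. s j i * y i (axis l 1))) = 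
          of_real (x \<theta> $ l * axis l 1 $ j)"
        by (simp only: sum_distrib_left[symmetric] of_real_mult)
      from arg_cong[OF this, of Re] show ?thesis
        by (simp only: E_def vec_lambda_beta Re_sum Re_complex_of_real)
    qed
    then have "(\<Sum>l\<in>UNIV. \<Sum>\<mu>\<in>range d. E \<mu> (\<lambda>\<theta>. of_real (x \<theta> $ l)) (axis l 1) \<theta>) $ j = 
        (\<Sum>l\<in>UNIV. x \<theta> $ l * axis l 1 $ j)" 
      by (simp only: sum_component)
    also have "\<dots> = x \<theta> $ j" by (simp add: axis_def if_distrib cong: if_cong)
    finally show "(\<Sum>l\<in>UNIV. \<Sum>\<mu>\<in>range d. E \<mu> (\<lambda>\<theta>. of_real (x \<theta> $ l)) (axis l 1) \<theta>) $ j = x \<theta> $ j" .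
  qed
  ultimately show ?thesis by simp
qed

subsection \<open>The matrix exponential and continuous-time states\<close>

lemma bilinear_matrix_vector: "bilinear (\<lambda>(X :: real ^ 'n ^ 'm) v. X *v v)"
  unfolding bilinear_def
  by (auto intro!: linearI simp: matrix_vector_right_distrib matrix_vector_mult_scaleR
      matrix_vector_mult_def vec_eq_iff sum.distrib sum_distrib_left algebra_simps)

text \<open>The norm of the vec type is the Frobenius norm, so an operator bound is transferred
  entry by entry, at the cost of a dimension factor.\<close>

lemma matrix_norm_le:
  fixes X :: "real ^ 'n ^ 'm"
  assumes "\<And>v. norm (X *v v) \<le> c * norm v"
  shows "norm X \<le> real (CARD('m) * CARD('n)) * c"
proof -
  have ent: "\<bar>X $ i $ j\<bar> \<le> c" for i j
    using order_trans[OF component_le_norm_cart assms[of "axis j 1"], of i]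
    by (simp add: matrix_vector_mult_basis column_def)
  have "norm X = L2_set (\<lambda>i. norm (X $ i)) UNIV" by (simp add: norm_vec_def)
  also have "\<dots> \<le> (\<Sum>i\<in>UNIV. norm (X $ i))" by (rule L2_set_le_sum) auto
  also have "\<dots> \<le> (\<Sum>i\<in>(UNIV :: 'm set). real CARD('n) * c)"
  proof (rule sum_mono)
    fix i
    have "norm (X $ i) \<le> (\<Sum>j\<in>UNIV. \<bar>X $ i $ j\<bar>)" by (rule norm_le_l1_cart)
    also have "\<dots> \<le> (\<Sum>j\<in>(UNIV :: 'n set). c)" by (intro sum_mono ent)
    finally show "norm (X $ i) \<le> real CARD('n) * c" by simp
  qed
  finally show ?thesis by simp
qed

text \<open>The operator bound is iterated along the powers and converted to the vec norm only once;
  hence the factor \<open>N\<close> is independent of k.\<close>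

lemma matpow_norm_bound:
  fixes A :: "real ^ 'n ^ 'n"
  obtains N c where "N > 0" "c > 0" "\<And>k. norm (matpow A k) \<le> N * c ^ k"
proof -
  obtain c where c: "c > 0" "\<And>v. norm (A *v v) \<le> norm v * c"
    using bounded_linear.pos_bounded[OF matrix_vector_mul_bounded_linear[of A]] by blast
  have "norm (matpow A k *v v) \<le> c ^ k * norm v" for k v
  proof (induction k)
    case (Suc k)
    have "norm (matpow A (Suc k) *v v) \<le> norm (matpow A k *v v) * c"
      unfolding matpow_Suc_vec by (rule c)
    also have "\<dots> \<le> (c ^ k * norm v) * c" using c(1) by (intro mult_right_mono Suc) auto
    finally show ?case by (simp add: mult_ac)
  qed simp
  then have "norm (matpow A k) \<le> real (CARD('n) * CARD('n)) * c ^ k" for k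
    by (rule matrix_norm_le)
  with c(1) show ?thesis by (intro that[of "real (CARD('n) * CARD('n))" c]) auto
qed

lemma summable_exp_coeffs: "summable (\<lambda>k. N * (c ^ k / fact k))" for N c :: real
  using summable_exp[of c] by (intro summable_mult) (simp add: divide_inverse mult.commute)

lemma matexp_summable:
  fixes A :: "real ^ 'n ^ 'n"
  shows "summable (\<lambda>k. norm (matpow A k /\<^sub>R fact k))"
proof -
  obtain N c where Nc: "N > 0" "c > 0" "\<And>k. norm (matpow A k) \<le> N * c ^ k"
    using matpow_norm_bound[of A] by blast
  show ?thesis
  proof (rule summable_comparison_test'[OF summable_exp_coeffs[of N c]])
    show "norm (norm (matpow A k /\<^sub>R fact k)) \<le> N * (c ^ k / fact k)" for k
      using Nc(3)[of k] by (simp add: divide_simps)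
  qed
qed

lemma matexp_linear_functional:
  fixes A :: "real ^ 'n ^ 'n" and h :: "real ^ 'n ^ 'n \<Rightarrow> real"
  assumes h: "bounded_linear h"
  shows "h (matexp (r *\<^sub>R A)) = (\<Sum>k. r ^ k / fact k * h (matpow A k))"
proof -
  interpret h: bounded_linear h by (rule h)
  have "h (matexp (r *\<^sub>R A)) = (\<Sum>k. h (matpow (r *\<^sub>R A) k /\<^sub>R fact k))"
    unfolding matexp_def by (rule h.suminf) (rule summable_norm_cancel[OF matexp_summable])
  then show ?thesis by (simp add: matpow_scaleR h.scaleR divide_inverse mult.commute mult.left_commute)
qed

lemma continuous_matexp:
  fixes A :: "real ^ 'n ^ 'n"
  shows "continuous_on {0..T} (\<lambda>s. matexp ((T - s) *\<^sub>R A))"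
proof -
  obtain N c where Nc: "N > 0" "c > 0" "\<And>k. norm (matpow A k) \<le> N * c ^ k"
    using matpow_norm_bound[of A] by blast
  have "uniform_limit {0..T} (\<lambda>n s. \<Sum>k<n. matpow ((T - s) *\<^sub>R A) k /\<^sub>R fact k) 
      (\<lambda>s. \<Sum>k. matpow ((T - s) *\<^sub>R A) k /\<^sub>R fact k) sequentially"
  proof (rule Weierstrass_m_test)
    fix k s assume s: "s \<in> {0..T}"
    have "norm (matpow ((T - s) *\<^sub>R A) k /\<^sub>R fact k) = (T - s) ^ k * norm (matpow A k) / fact k"
      using s by (simp add: matpow_scaleR power_abs divide_inverse)
    also have "\<dots> \<le> T ^ k * (N * c ^ k) / fact k"
      using s Nc by (intro divide_right_mono mult_mono power_mono) auto
    finally show "norm (matpow ((T - s) *\<^sub>R A) k /\<^sub>R fact k) \<le> N * ((T * c) ^ k / fact k)"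
      by (simp add: power_mult_distrib mult_ac)
  next
    show "summable (\<lambda>k. N * ((T * c) ^ k / fact k))" by (rule summable_exp_coeffs)
  qed
  then show ?thesis unfolding matexp_def
    by (rule uniform_limit_theorem[rotated])
       (auto intro!: always_eventually continuous_intros simp: matpow_scaleR)
qed

text \<open>For 0 \<le> \<tau> \<le> 1 each tail term contains \<tau>^n, and the rest is dominated
  by the full majorant series at |R| c. So one constant serves all \<theta>, \<tau> and n.\<close>

lemma matexp_taylor_bound:
  fixes A :: "real ^ 'n ^ 'n"
  obtains c where "c > 0" 
    "\<And>\<theta> \<tau> n. \<bar>\<theta>\<bar> \<le> R \<Longrightarrow> 0 \<le> \<tau> \<Longrightarrow> \<tau> \<le> 1 \<Longrightarrow>
      norm (matexp (\<tau> *\<^sub>R (\<theta> *\<^sub>R A)) - (\<Sum>k<n. (\<tau> ^ k / fact k) *\<^sub>R (\<theta> ^ k *\<^sub>R matpow A k))) \<le> c * \<tau> ^ n"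
proof -
  obtain N c where Nc: "N > 0" "c > 0" "\<And>k. norm (matpow A k) \<le> N * c ^ k"
    using matpow_norm_bound[of A] by blast
  define C where "C = (\<Sum>k. N * ((\<bar>R\<bar> * c) ^ k / fact k)) + 1"
  have C: "C > 0" unfolding C_def using Nc 
    by (intro add_nonneg_pos suminf_nonneg summable_exp_coeffs) auto
  show ?thesis
  proof (rule that[OF C])
    fix \<theta> \<tau> :: real and n assume \<theta>: "\<bar>\<theta>\<bar> \<le> R" and \<tau>: "0 \<le> \<tau>" "\<tau> \<le> 1"
    define a where "a = (\<lambda>k. matpow (\<tau> *\<^sub>R (\<theta> *\<^sub>R A)) k /\<^sub>R fact k)"
    have a: "a k = (\<tau> ^ k / fact k) *\<^sub>R (\<theta> ^ k *\<^sub>R matpow A k)" for k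
      by (simp add: a_def matpow_scaleR power_mult_distrib divide_inverse mult_ac)
    have sa: "summable (\<lambda>k. norm (a k))" unfolding a_def by (rule matexp_summable)
    have bound: "norm (a (k + n)) \<le> \<tau> ^ n * (N * ((\<bar>R\<bar> * c) ^ (k + n) / fact (k + n)))" for k
    proof -
      have "norm (a (k + n)) = \<tau> ^ (k + n) * (\<bar>\<theta>\<bar> ^ (k + n) * norm (matpow A (k + n))) / fact (k + n)"
        using \<tau> by (simp add: a power_abs abs_mult)
      also have "\<dots> \<le> \<tau> ^ n * (\<bar>R\<bar> ^ (k + n) * (N * c ^ (k + n))) / fact (k + n)"
        using \<tau> \<theta> Nc by (intro divide_right_mono mult_mono power_mono power_decreasing) auto
      finally show ?thesis by (simp add: power_mult_distrib mult_ac)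
    qed
    have "matexp (\<tau> *\<^sub>R (\<theta> *\<^sub>R A)) - (\<Sum>k<n. a k) = (\<Sum>k. a (k + n))"
      unfolding matexp_def a_def[symmetric]
      using suminf_split_initial_segment[OF summable_norm_cancel[OF sa], of n] by (simp add: a_def)
    also have "norm \<dots> \<le> (\<Sum>k. norm (a (k + n)))"
      by (rule summable_norm) (rule summable_ignore_initial_segment[OF sa])
    also have "\<dots> \<le> (\<Sum>k. \<tau> ^ n * (N * ((\<bar>R\<bar> * c) ^ (k + n) / fact (k + n))))"
      by (intro suminf_le bound summable_ignore_initial_segment[OF sa] summable_mult
          summable_ignore_initial_segment[OF summable_exp_coeffs])
    also have "\<dots> = \<tau> ^ n * (\<Sum>k. N * ((\<bar>R\<bar> * c) ^ (k + n) / fact (k + n)))"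
      by (rule suminf_mult) (rule summable_ignore_initial_segment[OF summable_exp_coeffs])
    also have "\<dots> \<le> \<tau> ^ n * C"
    proof (rule mult_left_mono)
      have "(\<Sum>k<n. N * ((\<bar>R\<bar> * c) ^ k / fact k)) \<ge> 0" using Nc by (intro sum_nonneg) auto
      then show "(\<Sum>k. N * ((\<bar>R\<bar> * c) ^ (k + n) / fact (k + n))) \<le> C"
        unfolding C_def using suminf_split_initial_segment[OF summable_exp_coeffs[of N "\<bar>R\<bar> * c"], of n] by simp
    qed (use \<tau> in auto)
    finally show "norm (matexp (\<tau> *\<^sub>R (\<theta> *\<^sub>R A)) - (\<Sum>k<n. (\<tau> ^ k / fact k) *\<^sub>R (\<theta> ^ k *\<^sub>R matpow A k))) \<le> C * \<tau> ^ n"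
      unfolding a by (simp add: mult.commute)
  qed
qed

text \<open>A bounded continuous kernel applied to an L^1 function; this links the Lebesgue integral
  of \<open>ct_state\<close> with the gauge integral.\<close>

lemma ct_integrand:
  fixes A :: "real ^ 'n ^ 'n" and B :: "real ^ 'm ^ 'n"
  assumes u: "u absolutely_integrable_on {0..T}"
  shows "(\<lambda>s. matexp ((T - s) *\<^sub>R (\<theta> *\<^sub>R A)) *v (B *v u s)) absolutely_integrable_on {0..T}"
proof -
  have cont: "continuous_on {0..T} (\<lambda>s. matexp ((T - s) *\<^sub>R (\<theta> *\<^sub>R A)))" by (rule continuous_matexp)
  have "(\<lambda>s. B *v u s) absolutely_integrable_on {0..T}"
    using absolutely_integrable_linear[OF u matrix_vector_mul_bounded_linear[of B]] by (simp add: o_def)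
  then show ?thesis
    by (intro absolutely_integrable_bounded_measurable_product[OF bilinear_matrix_vector,
          where f = "\<lambda>s. matexp ((T - s) *\<^sub>R (\<theta> *\<^sub>R A))" and g = "\<lambda>s. B *v u s"] continuous_imp_measurable_on_sets_lebesgue cont compact_imp_bounded compact_continuous_image) auto
qed

lemma ct_state_integral:
  assumes "u absolutely_integrable_on {0..T}"
  shows "((\<lambda>s. matexp ((T - s) *\<^sub>R (\<theta> *\<^sub>R A)) *v (B *v u s)) has_integral ct_state A B T \<theta> u) {0..T}"
  using set_lebesgue_integral_eq_integral[OF ct_integrand[OF assms, of \<theta> A B]] unfolding ct_state_def
  by (auto simp: has_integral_integral)

text \<open>The horizon is fixed, so that inputs on the same interval can be added and the set is a
  subspace.\<close>

definition ct_reach :: "real ^ 'n ^ 'n \<Rightarrow> real ^ 'm ^ 'n \<Rightarrow> real \<Rightarrow> (real \<Rightarrow> real ^ 'n) set" where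
  "ct_reach A B T = {\<lambda>\<theta>. ct_state A B T \<theta> u | u. u absolutely_integrable_on {0..T}}"

lemma ct_reachI: "u absolutely_integrable_on {0..T} \<Longrightarrow> (\<lambda>\<theta>. ct_state A B T \<theta> u) \<in> ct_reach A B T"
  unfolding ct_reach_def by blast

lemma ct_reachE:
  assumes "f \<in> ct_reach A B T"
  obtains u where "u absolutely_integrable_on {0..T}" "f = (\<lambda>\<theta>. ct_state A B T \<theta> u)"
  using assms unfolding ct_reach_def by (elim CollectE exE conjE)

lemma ct_reach_subspace: "function_subspace (ct_reach A B T)"
proof
  show "(\<lambda>x. 0) \<in> ct_reach A B T"
    using ct_reachI[where u = "\<lambda>_. 0" and T = T and A = A and B = B] by (simp add: ct_state_def set_lebesgue_integral_def set_integrable_def)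
  show "(\<lambda>x. c *\<^sub>R f x) \<in> ct_reach A B T" if f: "f \<in> ct_reach A B T" for f c
  proof -
    obtain u where u: "u absolutely_integrable_on {0..T}" "f = (\<lambda>\<theta>. ct_state A B T \<theta> u)"
      using f by (elim ct_reachE)
    have "ct_state A B T \<theta> (\<lambda>s. c *\<^sub>R u s) = c *\<^sub>R ct_state A B T \<theta> u" for \<theta>
      by (simp add: ct_state_def matrix_vector_mult_scaleR)
    moreover have "(\<lambda>s. c *\<^sub>R u s) absolutely_integrable_on {0..T}" using u(1) by simp
    ultimately show ?thesis using ct_reachI[where u = "\<lambda>s. c *\<^sub>R u s" and T = T and A = A and B = B] by (simp add: u(2))
  qed
  show "(\<lambda>x. f x + g x) \<in> ct_reach A B T" if f: "f \<in> ct_reach A B T" and g: "g \<in> ct_reach A B T" for f g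
  proof -
    obtain u where u: "u absolutely_integrable_on {0..T}" "f = (\<lambda>\<theta>. ct_state A B T \<theta> u)"
      using f by (elim ct_reachE)
    obtain v where v: "v absolutely_integrable_on {0..T}" "g = (\<lambda>\<theta>. ct_state A B T \<theta> v)"
      using g by (elim ct_reachE)
    have "ct_state A B T \<theta> (\<lambda>s. u s + v s) = ct_state A B T \<theta> u + ct_state A B T \<theta> v" for \<theta>
      using set_integral_add(2)[OF ct_integrand[OF u(1), of \<theta> A B] ct_integrand[OF v(1), of \<theta> A B]]
      by (simp add: ct_state_def matrix_vector_right_distrib)
    moreover have "(\<lambda>s. u s + v s) absolutely_integrable_on {0..T}" using u(1) v(1) by (rule set_integral_add(1))
    ultimately show ?thesis using ct_reachI[where u = "\<lambda>s. u s + v s" and T = T and A = A and B = B] by (simp add: u(2) v(2))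
  qed
qed

section \<open>Recovery of monomials from short constant inputs\<close>

lemma has_integral_power_tail:
  assumes "0 \<le> t"
  shows "((\<lambda>s. (1 - s) ^ k / fact k) has_integral (t ^ Suc k / fact (Suc k))) {1 - t..1::real}"
proof -
  have "((\<lambda>s. (1 - s) ^ k / fact k) has_integral
      (- ((1 - 1) ^ Suc k / fact (Suc k)) - (- ((1 - (1 - t)) ^ Suc k / fact (Suc k))))) {1 - t..1::real}"
  proof (rule fundamental_theorem_of_calculus)
    show "1 - t \<le> 1" using assms by simp
    fix x :: real
    show "((\<lambda>s. - ((1 - s) ^ Suc k / fact (Suc k))) has_vector_derivative (1 - x) ^ k / fact k) 
        (at x within {1 - t..1})"
      unfolding has_real_derivative_iff_has_vector_derivative[symmetric]
      by (rule derivative_eq_intros refl | simp)+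
  qed
  then show ?thesis by simp
qed

text \<open>A constant input \<open>w\<close> on \<open>[1 - t, 1]\<close> steers to
  \<open>\<Sum>k. t^(k+1)/(k+1)! * \<theta>^k * A^k B w\<close>; dividing by powers of \<open>t\<close> and letting \<open>t\<close> tend to \<open>0\<close>
  isolates the coefficients one after another.\<close>

lemma monomial_in_ct_closure:
  fixes A :: "real ^ 'n ^ 'n" and B :: "real ^ 'm ^ 'n"
  assumes P: "bounded P"
  shows "(\<lambda>\<theta>. \<theta> ^ k *\<^sub>R (matpow A k *v (B *v w))) \<in> uniform_closure P (ct_reach A B 1)"
proof -
  interpret V: function_subspace "uniform_closure P (ct_reach A B 1)"
    by (rule function_subspace.closure_subspace[OF ct_reach_subspace])
  obtain R where R: "\<And>\<theta>. \<theta> \<in> P \<Longrightarrow> \<bar>\<theta>\<bar> \<le> R" using P by (auto simp: bounded_iff)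
  obtain c where c: "c > 0" "\<And>\<theta> \<tau> n. \<bar>\<theta>\<bar> \<le> R \<Longrightarrow> 0 \<le> \<tau> \<Longrightarrow> \<tau> \<le> 1 \<Longrightarrow>
      norm (matexp (\<tau> *\<^sub>R (\<theta> *\<^sub>R A)) - (\<Sum>k<n. (\<tau> ^ k / fact k) *\<^sub>R (\<theta> ^ k *\<^sub>R matpow A k))) \<le> c * \<tau> ^ n"
    using matexp_taylor_bound[where A = A and R = R] by blast
  obtain D where D: "D > 0" "\<And>(X :: real ^ 'n ^ 'n) v. norm (X *v v) \<le> D * norm X * norm v"
    using bilinear_bounded_pos[OF bilinear_matrix_vector] by blast
  define b where "b = B *v w"
  define q where "q = (\<lambda>k \<theta>. \<theta> ^ k *\<^sub>R (matpow A k *v b))"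
  define M where "M = D * c * norm b + 1"
  have M: "M > 0" unfolding M_def using D c by (intro add_nonneg_pos) auto
  \<comment> \<open>The Taylor remainder of order t^n is integrated over an interval of length t,
    which gains one more power of t.\<close>
  have approx: "\<exists>f\<in>ct_reach A B 1. \<forall>\<theta>\<in>P. norm (f \<theta> - (\<Sum>k<n. (t ^ Suc k / fact (Suc k)) *\<^sub>R q k \<theta>)) \<le> M * t ^ Suc n"
    if t: "0 < t" "t \<le> 1" for t n
  proof -
    define u where "u = (\<lambda>s. if s \<in> {1 - t..1} then w else 0)"
    have u: "u absolutely_integrable_on {0..1}"
    proof -
      have "(\<lambda>s. w) absolutely_integrable_on {1 - t..1}"
        by (intro absolutely_integrable_continuous_real continuous_intros)
      then have "u absolutely_integrable_on UNIV" unfolding u_def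
        by (simp only: absolutely_integrable_restrict_UNIV)
      then show ?thesis by (rule set_integrable_subset) auto
    qed
    have "norm (ct_state A B 1 \<theta> u - (\<Sum>k<n. (t ^ Suc k / fact (Suc k)) *\<^sub>R q k \<theta>)) \<le> M * t ^ Suc n"
      if \<theta>: "\<theta> \<in> P" for \<theta>
    proof -
      have "((\<lambda>s. if s \<in> {1 - t..1} then matexp ((1 - s) *\<^sub>R (\<theta> *\<^sub>R A)) *v b else 0) 
          has_integral ct_state A B 1 \<theta> u) {0..1}"
        using ct_state_integral[OF u, of \<theta> A B] unfolding u_def b_def
        by (rule has_integral_eq[rotated]) auto
      then have i1: "((\<lambda>s. matexp ((1 - s) *\<^sub>R (\<theta> *\<^sub>R A)) *v b) has_integral ct_state A B 1 \<theta> u) {1 - t..1}"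
        using t by (subst (asm) has_integral_restrict) auto
      have i2: "((\<lambda>s. \<Sum>k<n. ((1 - s) ^ k / fact k) *\<^sub>R q k \<theta>) has_integral 
          (\<Sum>k<n. (t ^ Suc k / fact (Suc k)) *\<^sub>R q k \<theta>)) {1 - t..1}"
        using t by (intro has_integral_sum has_integral_scaleR_left has_integral_power_tail) auto
      have "norm (ct_state A B 1 \<theta> u - (\<Sum>k<n. (t ^ Suc k / fact (Suc k)) *\<^sub>R q k \<theta>)) \<le> (M * t ^ n) * measure lborel (cbox (1 - t) 1)"
      proof (rule has_integral_bound)
        show "0 \<le> M * t ^ n" using M t by simp
        show "((\<lambda>s. matexp ((1 - s) *\<^sub>R (\<theta> *\<^sub>R A)) *v b - (\<Sum>k<n. ((1 - s) ^ k / fact k) *\<^sub>R q k \<theta>)) has_integral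
            ct_state A B 1 \<theta> u - (\<Sum>k<n. (t ^ Suc k / fact (Suc k)) *\<^sub>R q k \<theta>)) (cbox (1 - t) 1)"
          using has_integral_diff[OF i1 i2] by simp
        fix s assume "s \<in> cbox (1 - t) 1"
        then have s: "0 \<le> 1 - s" "1 - s \<le> t" by auto
        let ?X = "matexp ((1 - s) *\<^sub>R (\<theta> *\<^sub>R A)) - (\<Sum>k<n. ((1 - s) ^ k / fact k) *\<^sub>R (\<theta> ^ k *\<^sub>R matpow A k))"
        interpret bl: linear "\<lambda>X. X *v b" using bilinear_matrix_vector unfolding bilinear_def by blast
        have "matexp ((1 - s) *\<^sub>R (\<theta> *\<^sub>R A)) *v b - (\<Sum>k<n. ((1 - s) ^ k / fact k) *\<^sub>R q k \<theta>) = ?X *v b"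
          by (simp only: bl.diff bl.sum bl.scale q_def)
        also have "norm \<dots> \<le> D * norm ?X * norm b" by (rule D)
        also have "\<dots> \<le> D * (c * t ^ n) * norm b"
        proof (intro mult_right_mono mult_left_mono)
          have "norm ?X \<le> c * (1 - s) ^ n" using s t R[OF \<theta>] by (intro c(2)) auto
          also have "\<dots> \<le> c * t ^ n" using s c by (intro mult_left_mono power_mono) auto
          finally show "norm ?X \<le> c * t ^ n" .
        qed (use D in auto)
        also have "\<dots> = (D * c * norm b) * t ^ n" by simp
        also have "\<dots> \<le> M * t ^ n" using t by (intro mult_right_mono) (auto simp: M_def)
        finally show "norm (matexp ((1 - s) *\<^sub>R (\<theta> *\<^sub>R A)) *v b - (\<Sum>k<n. ((1 - s) ^ k / fact k) *\<^sub>R q k \<theta>)) \<le> M * t ^ n" .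
      qed
      then show ?thesis using t by (simp add: mult_ac)
    qed
    moreover have "(\<lambda>\<theta>. ct_state A B 1 \<theta> u) \<in> ct_reach A B 1" using u by (rule ct_reachI)
    ultimately show ?thesis by (intro bexI[of _ "\<lambda>\<theta>. ct_state A B 1 \<theta> u"] ballI)
  qed
  have "q k \<in> uniform_closure P (ct_reach A B 1)"
  proof (induction k rule: less_induct)
    case (less k)
    show ?case
    proof (rule uniform_closure_limit)
      fix e :: real assume e: "e > 0"
      \<comment> \<open>Rescaling by \<open>a\<close>, which normalises the coefficient of
        \<open>q k\<close> to 1, turns the error M t^(k+2) into (k+1)! M t, at most e/2 for this
        t.\<close>
      define t where "t = min 1 (e / (2 * (fact (Suc k) * M)))"
      have t: "0 < t" "t \<le> 1" using e M by (auto simp: t_def)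
      have "t \<le> e / (2 * (fact (Suc k) * M))" by (simp add: t_def)
      then have "2 * (fact (Suc k) * M * t) \<le> e" using M by (simp add: pos_le_divide_eq mult_ac del: fact_Suc)
      then have te: "fact (Suc k) * M * t < e" using e by linarith
      obtain f where f: "f \<in> ct_reach A B 1"
        "\<And>\<theta>. \<theta> \<in> P \<Longrightarrow> norm (f \<theta> - (\<Sum>i<Suc k. (t ^ Suc i / fact (Suc i)) *\<^sub>R q i \<theta>)) \<le> M * t ^ Suc (Suc k)"
        using approx[OF t, of "Suc k"] by blast
      define a where "a = fact (Suc k) / t ^ Suc k"
      have a: "a > 0" "a * (t ^ Suc k / fact (Suc k)) = 1" using t by (simp_all add: a_def del: fact_Suc power_Suc)
      define g where "g = (\<lambda>\<theta>. a *\<^sub>R (f \<theta> + (-1) *\<^sub>R (\<Sum>i<k. (t ^ Suc i / fact (Suc i)) *\<^sub>R q i \<theta>)))"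
      \<comment> \<open>The lower-order terms subtracted in \<open>g\<close> lie in the closure by
        the induction hypothesis.\<close>
      have "g \<in> uniform_closure P (ct_reach A B 1)"
        unfolding g_def using less by (intro V.scale V.add V.sum uniform_closure_base[OF f(1)]) auto
      moreover have "norm (g \<theta> - q k \<theta>) < e" if \<theta>: "\<theta> \<in> P" for \<theta>
      proof -
        have "q k \<theta> = a *\<^sub>R ((t ^ Suc k / fact (Suc k)) *\<^sub>R q k \<theta>)" by (simp only: scaleR_scaleR a(2) scaleR_one)
        then have "g \<theta> - q k \<theta> = a *\<^sub>R (f \<theta> + (-1) *\<^sub>R (\<Sum>i<k. (t ^ Suc i / fact (Suc i)) *\<^sub>R q i \<theta>)) 
            - a *\<^sub>R ((t ^ Suc k / fact (Suc k)) *\<^sub>R q k \<theta>)" by (simp only: g_def)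
        also have "\<dots> = a *\<^sub>R (f \<theta> - (\<Sum>i<Suc k. (t ^ Suc i / fact (Suc i)) *\<^sub>R q i \<theta>))"
          unfolding scaleR_diff_right[symmetric] by (simp del: fact_Suc power_Suc)
        also have "norm \<dots> = a * norm (f \<theta> - (\<Sum>i<Suc k. (t ^ Suc i / fact (Suc i)) *\<^sub>R q i \<theta>))"
          using a(1) by simp
        also have "\<dots> \<le> a * (M * t ^ Suc (Suc k))"
          using a(1) f(2)[OF \<theta>] by (intro mult_left_mono) auto
        also have "\<dots> = fact (Suc k) * M * t" using t by (simp add: a_def del: fact_Suc)
        also have "\<dots> < e" by (rule te)
        finally show ?thesis .
      qed
      ultimately show "\<exists>g\<in>uniform_closure P (ct_reach A B 1). \<forall>\<theta>\<in>P. norm (g \<theta> - q k \<theta>) < e"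
        by (intro bexI[of _ g] ballI)
    qed
  qed
  then show ?thesis by (simp add: q_def b_def)
qed

lemma poly_states_subset_ct_closure:
  fixes A :: "real ^ 'n ^ 'n" and B :: "real ^ 'm ^ 'n"
  assumes "bounded P"
  shows "poly_states A B \<subseteq> uniform_closure P (ct_reach A B 1)"
proof
  interpret V: function_subspace "uniform_closure P (ct_reach A B 1)"
    by (rule function_subspace.closure_subspace[OF ct_reach_subspace])
  fix f assume "f \<in> poly_states A B"
  then show "f \<in> uniform_closure P (ct_reach A B 1)"
    unfolding poly_states_def by (auto intro!: V.sum monomial_in_ct_closure[OF assms])
qed

subsection \<open>Controllability as density\<close>

lemma poly_states_eq_dt:
  "poly_states A B = {\<lambda>\<theta>. dt_state A B T \<theta> u | T u. T > 0}"
proof (intro equalityI subsetI)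
  fix f assume "f \<in> poly_states A B"
  then obtain T w where f: "T > 0" "f = (\<lambda>\<theta>. \<Sum>k<T. \<theta> ^ k *\<^sub>R (matpow A k *v (B *v w k)))"
    unfolding poly_states_def by (elim CollectE exE conjE)
  have "f = (\<lambda>\<theta>. dt_state A B T \<theta> (\<lambda>i. w (T - 1 - i)))"
    unfolding f(2) dt_state_def
    by (intro ext sum.cong) (auto simp: matpow_scaleR scaleR_matrix_vector_assoc)
  then show "f \<in> {\<lambda>\<theta>. dt_state A B T \<theta> u | T u. T > 0}" 
    using f(1) by (intro CollectI exI conjI)
next
  fix f assume "f \<in> {\<lambda>\<theta>. dt_state A B T \<theta> u | T u. T > 0}"
  then obtain T u where f: "T > 0" "f = (\<lambda>\<theta>. dt_state A B T \<theta> u)"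
    by (elim CollectE exE conjE)
  have "f = (\<lambda>\<theta>. \<Sum>k<T. \<theta> ^ k *\<^sub>R (matpow A k *v (B *v u (T - 1 - k))))"
    unfolding f(2) dt_state_def
    by (intro ext sum.cong) (auto simp: matpow_scaleR scaleR_matrix_vector_assoc)
  then show "f \<in> poly_states A B" unfolding poly_states_def
    using f(1) by (intro CollectI exI[of _ T] exI[of _ "\<lambda>k. u (T - 1 - k)"] conjI)
qed

lemma SUP_norm_lessD:
  fixes f :: "'b \<Rightarrow> 'a::real_normed_vector"
  assumes "(SUP x\<in>S. ereal (norm (f x))) < ereal e" "x \<in> S"
  shows "norm (f x) < e"
  using SUP_lessD[OF assms] by simp

text \<open>The margin e/2 is there because a supremum of values below \<open>e\<close> may equal
  \<open>e\<close>.\<close>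

lemma SUP_norm_lessI:
  fixes f :: "'b \<Rightarrow> 'a::real_normed_vector"
  assumes "\<And>x. x \<in> S \<Longrightarrow> norm (f x) < e / 2" "0 < e"
  shows "(SUP x\<in>S. ereal (norm (f x))) < ereal e"
proof -
  have "(SUP x\<in>S. ereal (norm (f x))) \<le> ereal (e / 2)"
    by (rule SUP_least) (use assms in \<open>auto simp: less_imp_le\<close>)
  also have "\<dots> < ereal e" using \<open>0 < e\<close> by simp
  finally show ?thesis .
qed

lemma dt_uniformly_ensemble_controllable_iff:
  fixes A :: "real ^ 'n ^ 'n" and B :: "real ^ 'm ^ 'n"
  shows "dt_uniformly_ensemble_controllable P A B \<longleftrightarrow>
    (\<forall>x. continuous_on P x \<longrightarrow> x \<in> uniform_closure P (poly_states A B))"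
proof
  assume L: "dt_uniformly_ensemble_controllable P A B"
  show "\<forall>x. continuous_on P x \<longrightarrow> x \<in> uniform_closure P (poly_states A B)"
  proof (intro allI impI uniform_closureI)
    fix x :: "real \<Rightarrow> real ^ 'n" and e :: real assume x: "continuous_on P x" and e: "e > 0"
    obtain T u where Tu: "T > 0" "(SUP \<theta>\<in>P. ereal (norm (dt_state A B T \<theta> u - x \<theta>))) < ereal e"
      using L x e unfolding dt_uniformly_ensemble_controllable_def by blast
    have "(\<lambda>\<theta>. dt_state A B T \<theta> u) \<in> poly_states A B"
      unfolding poly_states_eq_dt using Tu(1) by (intro CollectI exI[of _ T] exI[of _ u] conjI refl)
    then show "\<exists>g\<in>poly_states A B. \<forall>\<theta>\<in>P. norm (g \<theta> - x \<theta>) < e"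
      by (rule bexI[rotated]) (auto intro: SUP_norm_lessD[OF Tu(2)])
  qed
next
  assume R: "\<forall>x. continuous_on P x \<longrightarrow> x \<in> uniform_closure P (poly_states A B)"
  show "dt_uniformly_ensemble_controllable P A B"
    unfolding dt_uniformly_ensemble_controllable_def
  proof (intro allI impI)
    fix x :: "real \<Rightarrow> real ^ 'n" and e :: real assume x: "continuous_on P x" and e: "e > 0"
    obtain g where g: "g \<in> poly_states A B" "\<And>\<theta>. \<theta> \<in> P \<Longrightarrow> norm (g \<theta> - x \<theta>) < e / 2"
      using uniform_closureE[OF R[rule_format, OF x], of "e / 2"] e by (metis half_gt_zero)
    obtain T u where Tu: "T > 0" "g = (\<lambda>\<theta>. dt_state A B T \<theta> u)"
      using g(1) unfolding poly_states_eq_dt by (elim CollectE exE conjE)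
    have "(SUP \<theta>\<in>P. ereal (norm (dt_state A B T \<theta> u - x \<theta>))) < ereal e"
      using g(2) e unfolding Tu(2) by (rule SUP_norm_lessI)
    then show "\<exists>T>0. \<exists>u. (SUP \<theta>\<in>P. ereal (norm (dt_state A B T \<theta> u - x \<theta>))) < ereal e"
      using Tu(1) by (intro exI[of _ T] exI[of _ u] conjI)
  qed
qed

text \<open>The union over horizons appears because T may depend on target and accuracy; in the
  converse direction one fixed horizon is supplied.\<close>

lemma ct_uniformly_ensemble_controllableD:
  assumes "ct_uniformly_ensemble_controllable P A B" "continuous_on P x"
  shows "x \<in> uniform_closure P (\<Union>T. ct_reach A B T)"
proof (rule uniform_closureI)
  fix e :: real assume e: "e > 0"
  obtain T u where u: "u absolutely_integrable_on {0..T}" 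
      and Tu: "(SUP \<theta>\<in>P. ereal (norm (ct_state A B T \<theta> u - x \<theta>))) < ereal e"
    using assms e unfolding ct_uniformly_ensemble_controllable_def by blast
  have "(\<lambda>\<theta>. ct_state A B T \<theta> u) \<in> (\<Union>T. ct_reach A B T)"
    using ct_reachI[OF u] by (rule UN_I[OF UNIV_I])
  then show "\<exists>g\<in>(\<Union>T. ct_reach A B T). \<forall>\<theta>\<in>P. norm (g \<theta> - x \<theta>) < e"
    by (rule bexI[rotated]) (auto intro: SUP_norm_lessD[OF Tu])
qed

lemma ct_uniformly_ensemble_controllableI:
  fixes A :: "real ^ 'n ^ 'n" and B :: "real ^ 'm ^ 'n"
  assumes "T > 0" "\<And>x. continuous_on P x \<Longrightarrow> x \<in> uniform_closure P (ct_reach A B T)"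
  shows "ct_uniformly_ensemble_controllable P A B"
  unfolding ct_uniformly_ensemble_controllable_def
proof (intro allI impI)
  fix x :: "real \<Rightarrow> real ^ 'n" and e :: real assume x: "continuous_on P x" and e: "e > 0"
  obtain g where g: "g \<in> ct_reach A B T" "\<And>\<theta>. \<theta> \<in> P \<Longrightarrow> norm (g \<theta> - x \<theta>) < e / 2"
    using uniform_closureE[OF assms(2)[OF x], of "e / 2"] e by (metis half_gt_zero)
  obtain u where u: "u absolutely_integrable_on {0..T}" "g = (\<lambda>\<theta>. ct_state A B T \<theta> u)"
    using g(1) by (elim ct_reachE)
  have "(SUP \<theta>\<in>P. ereal (norm (ct_state A B T \<theta> u - x \<theta>))) < ereal e"
    using g(2) e unfolding u(2) by (rule SUP_norm_lessI)
  then show "\<exists>T>0. \<exists>u. u absolutely_integrable_on {0..T} \<and> (SUP \<theta>\<in>P. ereal (norm (ct_state A B T \<theta> u - x \<theta>))) < ereal e"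
    using u(1) assms(1) by (intro exI[of _ T] exI[of _ u] conjI)
qed

subsection \<open>Necessary conditions\<close>

lemma not_surj_orthogonal:
  fixes X :: "real ^ 'n ^ 'm"
  assumes "\<not> surj ((*v) X)"
  obtains w where "w \<noteq> 0" "\<And>v. w \<bullet> (X *v v) = 0"
proof -
  have s: "span (range ((*v) X)) = range ((*v) X)"
    by (intro span_eq_iff[THEN iffD2] linear_subspace_image) auto
  then have "span (range ((*v) X)) \<subset> span (UNIV :: (real ^ 'm) set)"
    using assms unfolding s span_UNIV by blast
  then obtain w where "w \<noteq> 0" "\<And>y. y \<in> span (range ((*v) X)) \<Longrightarrow> orthogonal w y"
    using orthogonal_to_subspace_exists_gen by blast
  then show ?thesis using that[of w] unfolding s by (auto simp: orthogonal_def)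
qed

text \<open>A dimension count in place of Cayley-Hamilton: among the n + 1 vectors b, ..., A^n b
  some A^m b lies in the span of its predecessors, and that span is then invariant under
  \<open>A\<close>.\<close>

lemma krylov_stabilizes:
  fixes A :: "real ^ 'n ^ 'n"
  shows "matpow A k *v b \<in> span ((\<lambda>i. matpow A i *v b) ` {..<CARD('n)})"
proof -
  define f where "f = (\<lambda>i. matpow A i *v b)"
  have fS: "f (Suc i) = A *v f i" for i unfolding f_def by (rule matpow_Suc_vec)
  have "\<exists>m\<le>CARD('n). f m \<in> span (f ` {..<m})"
  proof (rule ccontr)
    assume H: "\<not> ?thesis"
    have "m \<le> Suc CARD('n) \<Longrightarrow> independent (f ` {..<m}) \<and> card (f ` {..<m}) = m" for m
    proof (induction m)
      case (Suc m)
      have nin: "f m \<notin> span (f ` {..<m})" using H Suc.prems by (simp add: Suc_le_mono)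
      have "f m \<notin> f ` {..<m}" by (rule contra_subsetD[OF span_superset nin])
      then show ?case using Suc.IH Suc.prems nin by (simp add: lessThan_Suc independent_insert)
    qed (simp add: independent_empty)
    from this[of "Suc CARD('n)"] have "independent (f ` {..<Suc CARD('n)})" "card (f ` {..<Suc CARD('n)}) = Suc CARD('n)"
      by auto
    then show False using independent_bound[of "f ` {..<Suc CARD('n)}"] by simp
  qed
  then obtain m where m: "m \<le> CARD('n)" "f m \<in> span (f ` {..<m})" by blast
  have "f k \<in> span (f ` {..<m})" for k
  proof (induction k)
    case 0
    show ?case
    proof (cases "m = 0")
      case True
      then show ?thesis using m(2) by simp
    next
      case False
      then show ?thesis by (intro span_base imageI) auto
    qed
  next
    case (Suc k)
    have "f (Suc k) \<in> (*v) A ` span (f ` {..<m})" using Suc unfolding fS by (rule imageI)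
    also have "\<dots> = span ((*v) A ` f ` {..<m})" by (intro linear_span_image[symmetric]) auto
    also have "\<dots> \<subseteq> span (f ` {..<m})"
    proof (rule span_minimal)
      \<comment> \<open>\<open>A\<close> shifts each spanning vector to the next; only the last
        leaves the list, and it becomes \<open>f m\<close>.\<close>
      show "(*v) A ` f ` {..<m} \<subseteq> span (f ` {..<m})"
      proof (clarsimp simp flip: fS)
        fix i assume "i < m"
        then show "f (Suc i) \<in> span (f ` {..<m})"
          using m(2) by (cases "Suc i = m") (auto intro: span_base)
      qed
    qed (rule subspace_span)
    finally show ?case .
  qed
  moreover have "span (f ` {..<m}) \<subseteq> span (f ` {..<CARD('n)})" using m(1) by (intro span_mono image_mono) auto
  ultimately show ?thesis unfolding f_def by blast
qed

text \<open>If the Kalman matrix lacks full rank, some nonzero \<open>w\<close> is orthogonal to its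
  range, hence to A^k B v for k < n, and by \<open>krylov_stabilizes\<close> for every k.\<close>

lemma controllableI:
  fixes A :: "real ^ 'n ^ 'n" and B :: "real ^ 'm ^ 'n"
  assumes "\<And>w. (\<And>k v. w \<bullet> (matpow A k *v (B *v v)) = 0) \<Longrightarrow> w = 0"
  shows "controllable A B"
proof (rule ccontr)
  assume "\<not> controllable A B"
  then have "\<not> surj ((*v) (kalman_matrix A B))" unfolding controllable_def full_rank_surjective .
  then obtain w where w: "w \<noteq> 0" "\<And>x. w \<bullet> (kalman_matrix A B *v x) = 0" by (rule not_surj_orthogonal) (rule that)
  have base: "w \<bullet> (matpow A k *v (B *v v)) = 0" if k: "k < CARD('n)" for k v
  proof -
    have "k \<in> to_nat_on (UNIV :: 'n set) ` UNIV"
      using to_nat_on_finite[of "UNIV :: 'n set"] k by (simp add: bij_betw_def)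
    then obtain i :: 'n where i: "k = to_nat_on UNIV i" by blast
    \<comment> \<open>Placing \<open>v\<close> in the block with exponent k and 0 elsewhere singles
      out A^k B v.\<close>
    define x :: "real ^ ('n \<times> 'm)" where "x = (\<chi> kj. if fst kj = i then v $ snd kj else 0)"
    have "(kalman_matrix A B *v x) $ l = (matpow A k *v (B *v v)) $ l" for l
    proof -
      have "(kalman_matrix A B *v x) $ l = (\<Sum>kj\<in>UNIV. kalman_matrix A B $ l $ kj * x $ kj)"
        by (simp add: matrix_vector_mult_def)
      also have "\<dots> = (\<Sum>kj\<in>UNIV \<times> UNIV. case kj of (a, j) \<Rightarrow> if a = i then (matpow A k ** B) $ l $ j * v $ j else 0)"
        by (intro sum.cong) (auto simp: kalman_matrix_def x_def i)
      also have "\<dots> = (\<Sum>a\<in>UNIV. \<Sum>j\<in>UNIV. if a = i then (matpow A k ** B) $ l $ j * v $ j else 0)"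
        by (rule sum.cartesian_product[symmetric])
      also have "\<dots> = (\<Sum>j\<in>UNIV. \<Sum>a\<in>UNIV. if a = i then (matpow A k ** B) $ l $ j * v $ j else 0)"
        by (rule sum.swap)
      also have "\<dots> = ((matpow A k ** B) *v v) $ l" by (simp add: matrix_vector_mult_def)
      finally show ?thesis by (simp add: matrix_vector_mul_assoc)
    qed
    then have "kalman_matrix A B *v x = matpow A k *v (B *v v)" by (simp add: vec_eq_iff)
    then show ?thesis using w(2)[of x] by simp
  qed
  have "w \<bullet> (matpow A k *v (B *v v)) = 0" for k v
  proof -
    have "span ((\<lambda>i. matpow A i *v (B *v v)) ` {..<CARD('n)}) \<subseteq> {x. w \<bullet> x = 0}"
      using base by (intro span_minimal subspace_hyperplane) auto
    then show ?thesis using krylov_stabilizes[of A k "B *v v"] by blast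
  qed
  with assms w(1) show False by blast
qed

text \<open>\<open>V\<close> stands for the reachable functions of either notion. The constant
  target w refutes density if w annihilates all A^k B v; the target \<theta>w refutes it if w
  annihilates the range of \<open>A\<close>.\<close>

lemma ensemble_necessary:
  fixes A :: "real ^ 'n ^ 'n" and B :: "real ^ 'm ^ 'n" and P :: "real set"
  assumes dense: "\<And>x. continuous_on P x \<Longrightarrow> x \<in> uniform_closure P V"
    and P: "\<alpha> \<in> P" "\<beta> \<in> P" "\<alpha> \<noteq> \<beta>"
    and V0: "\<And>w f. (\<And>k v. w \<bullet> (matpow A k *v (B *v v)) = 0) \<Longrightarrow> f \<in> V \<Longrightarrow> w \<bullet> f \<alpha> = 0"
    and V1: "\<And>w f. (\<And>v. w \<bullet> (A *v v) = 0) \<Longrightarrow> f \<in> V \<Longrightarrow> w \<bullet> f \<alpha> = w \<bullet> f \<beta>"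
  shows "controllable A B \<and> invertible A"
proof
  show "controllable A B"
  proof (rule controllableI, rule ccontr)
    fix w assume w: "\<And>k v. w \<bullet> (matpow A k *v (B *v v)) = 0" and w0: "w \<noteq> 0"
    have "(\<lambda>_. w) \<in> uniform_closure P V" by (rule dense) (rule continuous_on_const)
    then obtain f where f: "f \<in> V" "\<And>\<theta>. \<theta> \<in> P \<Longrightarrow> norm (f \<theta> - w) < norm w"
      using w0 by (elim uniform_closureE[where e = "norm w"]) auto
    have "norm w * norm w = \<bar>w \<bullet> (f \<alpha> - w)\<bar>"
      using V0[OF w f(1)] by (simp add: inner_diff_right dot_square_norm power2_eq_square)
    also have "\<dots> \<le> norm w * norm (f \<alpha> - w)" by (rule Cauchy_Schwarz_ineq2)
    also have "\<dots> < norm w * norm w" using f(2)[OF P(1)] w0 by (intro mult_strict_left_mono) auto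
    finally show False by simp
  qed
  show "invertible A"
  proof (rule ccontr)
    assume "\<not> invertible A"
    then have "\<not> surj ((*v) A)" by (simp add: invertible_right_inverse matrix_right_invertible_surjective)
    then obtain w where w: "w \<noteq> 0" "\<And>v. w \<bullet> (A *v v) = 0" by (rule not_surj_orthogonal) (rule that)
    \<comment> \<open>The components of \<theta>w along w at \<alpha> and \<beta> differ by
      |\<alpha> - \<beta>| |w|^2, while those of f agree; two errors below \<open>d\<close> cannot
      bridge this gap.\<close>
    define d where "d = \<bar>\<alpha> - \<beta>\<bar> * norm w / 2"
    have d: "d > 0" using w P by (simp add: d_def)
    have "(\<lambda>\<theta>. \<theta> *\<^sub>R w) \<in> uniform_closure P V" by (intro dense continuous_intros)
    then obtain f where f: "f \<in> V" "\<And>\<theta>. \<theta> \<in> P \<Longrightarrow> norm (f \<theta> - \<theta> *\<^sub>R w) < d"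
      using d by (elim uniform_closureE[where e = d]) auto
    have "\<bar>\<alpha> - \<beta>\<bar> * norm w * norm w = \<bar>w \<bullet> ((f \<beta> - \<beta> *\<^sub>R w) - (f \<alpha> - \<alpha> *\<^sub>R w))\<bar>"
      using V1[OF w(2) f(1)]
      by (simp add: inner_diff_right dot_square_norm power2_eq_square abs_mult flip: left_diff_distrib)
    also have "\<dots> \<le> norm w * norm ((f \<beta> - \<beta> *\<^sub>R w) - (f \<alpha> - \<alpha> *\<^sub>R w))" by (rule Cauchy_Schwarz_ineq2)
    also have "\<dots> < norm w * (d + d)"
    proof (rule mult_strict_left_mono)
      show "norm ((f \<beta> - \<beta> *\<^sub>R w) - (f \<alpha> - \<alpha> *\<^sub>R w)) < d + d"
        using norm_triangle_ineq4[of "f \<beta> - \<beta> *\<^sub>R w" "f \<alpha> - \<alpha> *\<^sub>R w"] f(2)[OF P(1)] f(2)[OF P(2)] by linarith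
    qed (use w in auto)
    finally show False by (simp add: d_def mult_ac)
  qed
qed

section \<open>Annihilators of the continuous-time reachable functions\<close>

lemma inner_matexp:
  fixes A :: "real ^ 'n ^ 'n"
  shows "w \<bullet> (matexp (r *\<^sub>R A) *v v) = (\<Sum>k. r ^ k / fact k * (w \<bullet> (matpow A k *v v)))"
proof (rule matexp_linear_functional)
  have "linear (\<lambda>X. (X :: real ^ 'n ^ 'n) *v v)" using bilinear_matrix_vector unfolding bilinear_def by blast
  then show "bounded_linear (\<lambda>X. w \<bullet> ((X :: real ^ 'n ^ 'n) *v v))"
    by (intro bounded_linear_inner_right_comp) (simp add: linear_conv_bounded_linear)
qed

lemma ct_state_inner:
  assumes u: "u absolutely_integrable_on {0..T}"
  shows "((\<lambda>s. w \<bullet> (matexp (((T - s) * \<theta>) *\<^sub>R A) *v (B *v u s))) has_integral w \<bullet> ct_state A B T \<theta> u) {0..T}"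
  using has_integral_linear[OF ct_state_integral[OF u, of \<theta> A B] bounded_linear_inner_right[of w]]
  by (simp add: o_def)

lemma inner_ct_reach_zero:
  assumes w: "\<And>k v. w \<bullet> (matpow A k *v (B *v v)) = 0" and f: "f \<in> ct_reach A B T"
  shows "w \<bullet> f \<theta> = 0"
proof -
  obtain u where u: "u absolutely_integrable_on {0..T}" "f = (\<lambda>\<theta>. ct_state A B T \<theta> u)"
    using f by (elim ct_reachE)
  have "((\<lambda>s. 0) has_integral w \<bullet> ct_state A B T \<theta> u) {0..T}"
    using ct_state_inner[OF u(1), of w \<theta> A B] unfolding inner_matexp w by simp
  from has_integral_unique[OF this has_integral_0] show ?thesis unfolding u(2) .
qed

lemma inner_matpow_left_null:
  assumes "\<And>v. w \<bullet> (A *v v) = 0"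
  shows "w \<bullet> (matpow A k *v v) = (if k = 0 then w \<bullet> v else 0)"
  using assms by (cases k) (simp_all add: matpow_Suc_vec del: matpow.simps(2))

text \<open>Only the k = 0 term of the exponential series survives pairing with w, and it does not
  involve \<theta>.\<close>

lemma inner_ct_reach_const:
  assumes w: "\<And>v. w \<bullet> (A *v v) = 0" and f: "f \<in> ct_reach A B T"
  shows "w \<bullet> f \<alpha> = w \<bullet> f \<beta>"
proof -
  obtain u where u: "u absolutely_integrable_on {0..T}" "f = (\<lambda>\<theta>. ct_state A B T \<theta> u)"
    using f by (elim ct_reachE)
  have "w \<bullet> (matexp (r *\<^sub>R A) *v v) = w \<bullet> v" for r v
  proof -
    have "(\<Sum>k. r ^ k / fact k * (w \<bullet> (matpow A k *v v))) = (\<Sum>k\<in>{0}. r ^ k / fact k * (w \<bullet> (matpow A k *v v)))"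
      by (rule suminf_finite) (auto simp: inner_matpow_left_null[OF w])
    then show ?thesis unfolding inner_matexp by simp
  qed
  then have *: "((\<lambda>s. w \<bullet> (B *v u s)) has_integral w \<bullet> ct_state A B T \<theta> u) {0..T}" for \<theta>
    using ct_state_inner[OF u(1), of w \<theta> A B] by simp
  show ?thesis unfolding u(2) by (rule has_integral_unique[OF * *])
qed

section \<open>Both directions for both notions\<close>

theorem theorem6:
  fixes P :: "real set" and \<I> :: "real set set"
    and A :: "real ^ 'n ^ 'n" and B :: "real ^ 'm ^ 'n"
  assumes "finite \<I>"
    and "\<forall>J\<in>\<I>. \<exists>a b. a \<le> b \<and> J = {a..b}"
    and "P = \<Union>\<I>"
    and "P \<noteq> {}"
    and "closure (interior P) = P"
    and "0 \<notin> P"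
  shows "(ct_uniformly_ensemble_controllable P A B \<longrightarrow> controllable A B \<and> invertible A) \<and>
         (dt_uniformly_ensemble_controllable P A B \<longrightarrow> controllable A B \<and> invertible A) \<and>
         (\<forall>(r::nat) (ev :: nat \<Rightarrow> complex).
            controllable A B \<and> invertible A \<and> diagonalizable (complex_matrix A) \<and>
            bij_betw ev {1..r} (eigenvalues (complex_matrix A)) \<and>
            (\<forall>k\<in>{1..r}. \<forall>l\<in>{1..r}. k \<noteq> l \<longrightarrow>
               scaled_set (ev k) P \<inter> scaled_set (ev l) P = {}) \<longrightarrow>
            ct_uniformly_ensemble_controllable P A B \<and>
            dt_uniformly_ensemble_controllable P A B)"
proof (intro conjI[of "_ \<longrightarrow> _"] impI allI)
  have P: "compact P" unfolding assms(3) using assms(1,2) by (intro compact_Union) auto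
  \<comment> \<open>\<open>P\<close> is the closure of its interior and nonempty, so it contains a
    nondegenerate interval.\<close>
  obtain \<alpha> \<beta> where \<alpha>\<beta>: "\<alpha> \<in> P" "\<beta> \<in> P" "\<alpha> \<noteq> \<beta>"
  proof -
    have "interior P \<noteq> {}" using assms(4,5) by auto
    then obtain a e where "e > 0" "cball a e \<subseteq> P" by (auto simp: mem_interior_cball)
    moreover from this have "a \<in> cball a e" "a + e \<in> cball a e" by (auto simp: dist_real_def)
    ultimately show ?thesis by (intro that[of a "a + e"]) auto
  qed
  show "controllable A B \<and> invertible A" if "ct_uniformly_ensemble_controllable P A B"
  proof (rule ensemble_necessary[OF ct_uniformly_ensemble_controllableD[OF that] \<alpha>\<beta>])
    fix w f assume "\<And>k v. w \<bullet> (matpow A k *v (B *v v)) = 0" "f \<in> (\<Union>T. ct_reach A B T)"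
    then show "w \<bullet> f \<alpha> = 0" using inner_ct_reach_zero by blast
  next
    fix w f assume w: "\<And>v. w \<bullet> (A *v v) = 0" and f: "f \<in> (\<Union>T. ct_reach A B T)"
    then show "w \<bullet> f \<alpha> = w \<bullet> f \<beta>" using inner_ct_reach_const by blast
  qed
  show "controllable A B \<and> invertible A" if "dt_uniformly_ensemble_controllable P A B"
  proof (rule ensemble_necessary[OF that[unfolded dt_uniformly_ensemble_controllable_iff, rule_format] \<alpha>\<beta>])
    fix w f assume w: "\<And>k v. w \<bullet> (matpow A k *v (B *v v)) = 0" and f: "f \<in> poly_states A B"
    then show "w \<bullet> f \<alpha> = 0" unfolding poly_states_def by (auto simp: inner_sum_right)
  next
    fix w f assume w: "\<And>v. w \<bullet> (A *v v) = 0" and f: "f \<in> poly_states A B"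
    then show "w \<bullet> f \<alpha> = w \<bullet> f \<beta>" unfolding poly_states_def
      by (auto simp: inner_sum_right inner_matpow_left_null[OF w] intro!: sum.cong)
  qed
  fix r :: nat and ev :: "nat \<Rightarrow> complex"
  assume H: "controllable A B \<and> invertible A \<and> diagonalizable (complex_matrix A) \<and>
            bij_betw ev {1..r} (eigenvalues (complex_matrix A)) \<and>
            (\<forall>k\<in>{1..r}. \<forall>l\<in>{1..r}. k \<noteq> l \<longrightarrow> scaled_set (ev k) P \<inter> scaled_set (ev l) P = {})"
  have disj: "scaled_set \<nu> P \<inter> scaled_set \<mu> P = {}"
    if ev_mem: "\<nu> \<in> eigenvalues (complex_matrix A)" "\<mu> \<in> eigenvalues (complex_matrix A)" and "\<nu> \<noteq> \<mu>" for \<nu> \<mu>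
  proof -
    have "eigenvalues (complex_matrix A) = ev ` {1..r}" using H by (auto simp: bij_betw_def)
    then obtain k l where kl: "k \<in> {1..r}" "l \<in> {1..r}" "\<nu> = ev k" "\<mu> = ev l" using ev_mem by auto
    have "\<forall>k\<in>{1..r}. \<forall>l\<in>{1..r}. k \<noteq> l \<longrightarrow> scaled_set (ev k) P \<inter> scaled_set (ev l) P = {}"
      using H by (elim conjE)
    then show ?thesis using kl \<open>\<nu> \<noteq> \<mu>\<close> by metis
  qed
  have dense: "x \<in> uniform_closure P (poly_states A B)" if "continuous_on P x" for x
    using H that by (intro poly_states_dense P assms(6) disj) auto
  then have "dt_uniformly_ensemble_controllable P A B"
    by (simp add: dt_uniformly_ensemble_controllable_iff)
  moreover have "x \<in> uniform_closure P (ct_reach A B 1)" if "continuous_on P x" for x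
    using dense[OF that] uniform_closure_mono[OF poly_states_subset_ct_closure[OF compact_imp_bounded[OF P]], of A B]
    by blast
  then have "ct_uniformly_ensemble_controllable P A B"
    by (intro ct_uniformly_ensemble_controllableI[where T = 1]) auto
  ultimately show "ct_uniformly_ensemble_controllable P A B \<and> dt_uniformly_ensemble_controllable P A B" by blast
qed

end
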